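(* Let $L$ be a bounded distributive lattice and let $X=L_*$ be its dual Priestley space. Then the Gödel algebra $\mathsf{CC}(X)^*$ (the clopen upsets of the Esakia root system $(\mathsf{CC}(X),\unlhd)$) is free over $L$ via the map $e\colon L\to \mathsf{CC}(X)^*$ given by $e(a)=\Box\,\sigma_L(a)=\{C\in\mathsf{CC}(X)\mid C\subseteq \sigma_L(a)\}$.
   Context: All lattices are bounded and lattice homomorphisms preserve bounds. A Priestley space is a compact space $X$ with a partial order $\le$ such that whenever $x\not\le y$ there is a clopen upset $U$ with $x\in U$, $y\notin U$. For a distributive lattice $L$, $L_*$ is the set of prime filters of $L$ ordered by inclusion, with topology generated by the sets $\sigma_L(a)=\{P\in L_*\mid a\in P\}$ and their complements ($a\in L$). A chain of $X$ is a totally ordered subset; $\mathsf{CC}(X)$ is the set of nonempty closed chains of $X$, topologized by the subbasis $\Box V=\{C\in\mathsf{CC}(X)\mid C\subseteq V\}$, $\Diamond V=\{C\in\mathsf{CC}(X)\mid C\cap V\neq\varnothing\}$ for $V$ clopen in $X$ (the subspace of the Vietoris topology), and ordered by $C_1\unlhd C_2$ iff $C_2\subseteq C_1$ and $C_2$ is an upset of $C_1$. An Esakia space is a Priestley space in which ${\downarrow}V$ is clopen for every clopen $V$; for an Esakia space $Y$, $Y^*$ is the Heyting algebra of clopen upsets of $Y$ with $U\to V=Y\setminus{\downarrow}(U\setminus V)$. A Gödel algebra is a Heyting algebra satisfying $(x\to y)\vee(y\to x)=1$. A Gödel algebra $G$ is free over $L$ via a lattice homomorphism $e\colon L\to G$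 if for every Gödel algebra $H$ and lattice homomorphism $f\colon L\to H$ there is a unique Heyting algebra homomorphism $g\colon G\to H$ with $g\circ e=f$. *)

theory Defs
  imports "HOL-Algebra.Lattice" "HOL-Analysis.Abstract_Topology"
begin

section \<open>Bounded distributive lattices, Heyting algebras and Goedel algebras\<close>

locale bounded_distributive_lattice = bounded_lattice +
  assumes meet_join_distrib:
    "\<lbrakk>x \<in> carrier L; y \<in> carrier L; z \<in> carrier L\<rbrakk>
      \<Longrightarrow> x \<sqinter> (y \<squnion> z) = (x \<sqinter> y) \<squnion> (x \<sqinter> z)"

definition bounded_lattice_hom ::
  "('a, 'm) gorder_scheme \<Rightarrow> ('b, 'n) gorder_scheme \<Rightarrow> ('a \<Rightarrow> 'b) \<Rightarrow> bool" where
  "bounded_lattice_hom L M f \<longleftrightarrow>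
     f \<in> carrier L \<rightarrow> carrier M \<and> join_pres L M f \<and> meet_pres L M f \<and>
     f \<bottom>\<^bsub>L\<^esub> = \<bottom>\<^bsub>M\<^esub> \<and> f \<top>\<^bsub>L\<^esub> = \<top>\<^bsub>M\<^esub>"

record 'a heyting = "'a gorder" +
  himp :: "['a, 'a] \<Rightarrow> 'a" (infixr \<open>\<rightharpoonup>\<index>\<close> 60)

locale heyting_algebra = bounded_lattice H for H (structure) +
  assumes himp_closed: "\<lbrakk>x \<in> carrier H; y \<in> carrier H\<rbrakk> \<Longrightarrow> x \<rightharpoonup> y \<in> carrier H"
    and himp_residual:
      "\<lbrakk>x \<in> carrier H; y \<in> carrier H; z \<in> carrier H\<rbrakk>
        \<Longrightarrow> z \<sqsubseteq> (x \<rightharpoonup> y) \<longleftrightarrow> (z \<sqinter> x) \<sqsubseteq> y"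

locale goedel_algebra = heyting_algebra +
  assumes prelinear:
    "\<lbrakk>x \<in> carrier H; y \<in> carrier H\<rbrakk> \<Longrightarrow> (x \<rightharpoonup> y) \<squnion> (y \<rightharpoonup> x) = \<top>"

definition heyting_hom ::
  "('a, 'm) heyting_scheme \<Rightarrow> ('b, 'n) heyting_scheme \<Rightarrow> ('a \<Rightarrow> 'b) \<Rightarrow> bool" where
  "heyting_hom G H g \<longleftrightarrow> bounded_lattice_hom G H g \<and>
     (\<forall>x\<in>carrier G. \<forall>y\<in>carrier G. g (x \<rightharpoonup>\<^bsub>G\<^esub> y) = g x \<rightharpoonup>\<^bsub>H\<^esub> g y)"

text \<open>HOL cannot quantify over types inside a formula, so the type \<open>'h\<close> hosting the test algebras
  \<open>H\<close> is a parameter; a theorem about \<open>TYPE('h)\<close> with \<open>'h\<close> a free type variable covers Goedel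
  algebras on carriers in every type. Maps are identified when they agree on the carrier,
  so uniqueness of \<open>g\<close> is stated for extensional functions.\<close>

definition free_goedel_over ::
  "'h itself \<Rightarrow> ('a, 'm) gorder_scheme \<Rightarrow> ('g, 'n) heyting_scheme \<Rightarrow> ('a \<Rightarrow> 'g) \<Rightarrow> bool" where
  "free_goedel_over _ L G e \<longleftrightarrow>
     goedel_algebra G \<and> bounded_lattice_hom L G e \<and>
     (\<forall>(H :: 'h heyting) f. goedel_algebra H \<and> bounded_lattice_hom L H f \<longrightarrow>
        (\<exists>!g. g \<in> extensional (carrier G) \<and> heyting_hom G H g \<and>
              (\<forall>a\<in>carrier L. g (e a) = f a)))"


section \<open>Priestley and Esakia spaces\<close>

text \<open>An ordered space is given by a topology \<open>T\<close> and a relation \<open>r\<close> on \<open>topspace T\<close>, where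
  \<open>(x, y) \<in> r\<close> means \<open>x \<le> y\<close>. Thus \<open>r\<inverse> `` V\<close> is the downset generated by \<open>V\<close>.\<close>

definition clopenin :: "'a topology \<Rightarrow> 'a set \<Rightarrow> bool" where
  "clopenin T V \<longleftrightarrow> openin T V \<and> closedin T V"

definition upset_of :: "'a set \<Rightarrow> ('a \<times> 'a) set \<Rightarrow> 'a set \<Rightarrow> bool" where
  "upset_of A r U \<longleftrightarrow> U \<subseteq> A \<and> (\<forall>x\<in>U. \<forall>y\<in>A. (x, y) \<in> r \<longrightarrow> y \<in> U)"

definition priestley_space :: "'a topology \<Rightarrow> ('a \<times> 'a) set \<Rightarrow> bool" where
  "priestley_space T r \<longleftrightarrow>
     compact_space T \<and> partial_order_on (topspace T) r \<and>
     (\<forall>x\<in>topspace T. \<forall>y\<in>topspace T. (x, y) \<notin> r \<longrightarrow>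
        (\<exists>U. clopenin T U \<and> upset_of (topspace T) r U \<and> x \<in> U \<and> y \<notin> U))"

definition esakia_space :: "'a topology \<Rightarrow> ('a \<times> 'a) set \<Rightarrow> bool" where
  "esakia_space T r \<longleftrightarrow>
     priestley_space T r \<and> (\<forall>V. clopenin T V \<longrightarrow> clopenin T (r\<inverse> `` V))"

text \<open>A root system is a poset in which every principal upset is a chain.\<close>

definition root_system :: "'a set \<Rightarrow> ('a \<times> 'a) set \<Rightarrow> bool" where
  "root_system A r \<longleftrightarrow> partial_order_on A r \<and> (\<forall>x\<in>A. r `` {x} \<in> Chains r)"

definition clopen_upset_algebra :: "'a topology \<Rightarrow> ('a \<times> 'a) set \<Rightarrow> 'a set heyting" where
  "clopen_upset_algebra T r =
     \<lparr>carrier = {U. clopenin T U \<and> upset_of (topspace T) r U}, eq = (=), le = (\<subseteq>),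
      himp = (\<lambda>U V. topspace T - r\<inverse> `` (U - V))\<rparr>"


section \<open>The dual space of a distributive lattice\<close>

definition prime_filter :: "('a, 'm) gorder_scheme \<Rightarrow> 'a set \<Rightarrow> bool" where
  "prime_filter L P \<longleftrightarrow>
     P \<subseteq> carrier L \<and> P \<noteq> {} \<and> P \<noteq> carrier L \<and>
     (\<forall>x\<in>P. \<forall>y\<in>carrier L. x \<sqsubseteq>\<^bsub>L\<^esub> y \<longrightarrow> y \<in> P) \<and>
     (\<forall>x\<in>P. \<forall>y\<in>P. x \<sqinter>\<^bsub>L\<^esub> y \<in> P) \<and>
     (\<forall>x\<in>carrier L. \<forall>y\<in>carrier L. x \<squnion>\<^bsub>L\<^esub> y \<in> P \<longrightarrow> x \<in> P \<or> y \<in> P)"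

definition prime_filters :: "('a, 'm) gorder_scheme \<Rightarrow> 'a set set" where
  "prime_filters L = {P. prime_filter L P}"

definition stone_map :: "('a, 'm) gorder_scheme \<Rightarrow> 'a \<Rightarrow> 'a set set" where
  "stone_map L a = {P \<in> prime_filters L. a \<in> P}"

definition dual_topology :: "('a, 'm) gorder_scheme \<Rightarrow> 'a set topology" where
  "dual_topology L = topology_generated_by
     (stone_map L ` carrier L \<union> (\<lambda>a. prime_filters L - stone_map L a) ` carrier L)"

definition dual_order :: "('a, 'm) gorder_scheme \<Rightarrow> ('a set \<times> 'a set) set" where
  "dual_order L = {(P, Q). P \<in> prime_filters L \<and> Q \<in> prime_filters L \<and> P \<subseteq> Q}"


section \<open>The space of nonempty closed chains\<close>

definition closed_chains :: "'a topology \<Rightarrow> ('a \<times> 'a) set \<Rightarrow> 'a set set" where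
  "closed_chains T r = {C. C \<noteq> {} \<and> closedin T C \<and> C \<in> Chains r}"

definition cc_box :: "'a topology \<Rightarrow> ('a \<times> 'a) set \<Rightarrow> 'a set \<Rightarrow> 'a set set" where
  "cc_box T r V = {C \<in> closed_chains T r. C \<subseteq> V}"

definition cc_diamond :: "'a topology \<Rightarrow> ('a \<times> 'a) set \<Rightarrow> 'a set \<Rightarrow> 'a set set" where
  "cc_diamond T r V = {C \<in> closed_chains T r. C \<inter> V \<noteq> {}}"

definition cc_topology :: "'a topology \<Rightarrow> ('a \<times> 'a) set \<Rightarrow> 'a set topology" where
  "cc_topology T r = topology_generated_by
     (cc_box T r ` {V. clopenin T V} \<union> cc_diamond T r ` {V. clopenin T V})"

definition cc_order :: "'a topology \<Rightarrow> ('a \<times> 'a) set \<Rightarrow> ('a set \<times> 'a set) set" where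
  "cc_order T r = {(C\<^sub>1, C\<^sub>2). C\<^sub>1 \<in> closed_chains T r \<and> C\<^sub>2 \<in> closed_chains T r \<and>
                             C\<^sub>2 \<subseteq> C\<^sub>1 \<and> upset_of C\<^sub>1 r C\<^sub>2}"

end

theory Submission
  imports Defs "HOL-Analysis.Function_Topology" "HOL-Analysis.T1_Spaces"
begin

text \<open>For a Goedel algebra \<open>H\<close> and \<open>f : L \<rightarrow> H\<close>, the prime filters of \<open>H\<close> above a given one form a
  chain, so sending a prime filter \<open>P\<close> to the set of all \<open>f\<inverse>(Q)\<close> with \<open>Q \<supseteq> P\<close> is a map from the dual of
  \<open>H\<close> to \<open>CC(X)\<close>; it is a p-morphism, hence taking preimages of clopen upsets respects the Heyting
  operations. That such a preimage has the form \<open>{P. h \<in> P}\<close>, and that the resulting homomorphism is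
  the only one, both follow because \<open>CC(X)\<^sup>*\<close> is generated as a Heyting algebra by the sets \<open>\<box>\<sigma>(a)\<close>:
  if \<open>C \<unlhd> D\<close> fails, then \<open>\<box>\<sigma>(a) \<rightarrow> \<box>\<sigma>(b)\<close> or \<open>(\<box>\<sigma>(a) \<rightarrow> \<box>\<sigma>(b)) \<rightarrow> \<box>\<sigma>(a)\<close>
  contains \<open>C\<close> but not \<open>D\<close> for suitable \<open>a, b\<close>, and by compactness a sublattice of clopen upsets that
  separates the order in this way is everything. The second set is \<open>\<box>\<sigma>(a) \<union> \<diamond>(\<sigma>(a) - \<sigma>(b))\<close>, which
  is visibly clopen, so the same sets show that \<open>CC(X)\<close> is a Priestley space.\<close>

section \<open>Prime filters and compactness of the dual space\<close>

text \<open>Two kinds of separating set are needed because \<open>C \<unlhd> D\<close> can fail in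
  two ways. If some \<open>d\<close> in \<open>D\<close> lies outside \<open>C\<close>, a clopen
  \<open>U - V\<close> around \<open>d\<close> that misses \<open>C\<close> gives a box containing
  \<open>C\<close> but not \<open>D\<close>. If \<open>D \<subseteq> C\<close> but some
  \<open>c\<close> in \<open>C\<close> outside \<open>D\<close> lies above a point of
  \<open>D\<close>, boxes are useless: each one containing \<open>C\<close> contains
  \<open>D\<close>. A diamond of \<open>U - V\<close> around \<open>c\<close> tells the two apart,
  but it is no upset, since a smaller chain may lose the witness. Adding the box of \<open>U\<close>
  repairs this: a chain above \<open>C\<close> that keeps a point outside \<open>U\<close> keeps
  every point of \<open>C\<close> above that point, in particular the witness in the upset
  \<open>U\<close>. The p-morphism condition has its own obstacle: an arbitrary \<open>D\<close>
  above the image chain of \<open>P\<close> must come from a single prime filter \<open>Q\<close>.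
  It is chosen over the least element of \<open>D\<close>, which exists because a closed chain of
  prime filters contains its intersection.\<close>

lemma compact_space_topology_generated_by:
  assumes "\<And>\<C>. \<C> \<subseteq> \<B> \<Longrightarrow> \<Union>\<C> = \<Union>\<B> \<Longrightarrow> \<exists>\<C>'. finite \<C>' \<and> \<C>' \<subseteq> \<C> \<and> \<Union>\<C>' = \<Union>\<B>"
  shows "compact_space (topology_generated_by \<B>)"
proof (rule Alexander_subbase)
  let ?P = "arbitrary union_of (finite intersection_of (\<lambda>x. x \<in> \<B>) relative_to \<Union>\<B>)"
  \<comment> \<open>\<open>Alexander_subbase\<close> speaks of unions of finite intersections
    relative to \<open>\<Union>\<B>\<close>; that form has to be matched with the inductively
    generated topology.\<close>
  have "?P S \<longleftrightarrow> generate_topology_on \<B> S" for S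
  proof
    assume "generate_topology_on \<B> S"
    then show "?P S"
    proof (rule generate_topology_on_coarsest[rotated 2])
      show "istopology ?P" by (rule istopology_subbase)
      fix B assume "B \<in> \<B>"
      then have "(finite intersection_of (\<lambda>x. x \<in> \<B>) relative_to \<Union>\<B>) (\<Union>\<B> \<inter> B)"
        by (intro relative_to_inc finite_intersection_of_inc)
      moreover have "\<Union>\<B> \<inter> B = B" using \<open>B \<in> \<B>\<close> by blast
      ultimately show "?P B" by (simp add: arbitrary_union_of_inc)
    qed
  next
    assume "?P S"
    moreover have "openin (topology_generated_by \<B>) (\<Union>\<B> \<inter> \<Inter>\<F>)"
      if "finite \<F>" "\<F> \<subseteq> \<B>" for \<F>
    \<comment> \<open>The empty intersection is the whole type; intersecting with
      \<open>\<Union>\<B>\<close> makes it the space.\<close>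
    proof (cases "\<F> = {}")
      case True
      then show ?thesis using openin_topspace[of "topology_generated_by \<B>"] by simp
    next
      case False
      then have "openin (topology_generated_by \<B>) (\<Inter>\<F>)"
        using that by (intro openin_Inter) (auto intro: topology_generated_by_Basis)
      moreover have "openin (topology_generated_by \<B>) (\<Union>\<B>)"
        using openin_topspace[of "topology_generated_by \<B>"] by simp
      ultimately show ?thesis by blast
    qed
    ultimately have *: "openin (topology_generated_by \<B>) T"
      if "(finite intersection_of (\<lambda>x. x \<in> \<B>) relative_to \<Union>\<B>) T" for T
      using that by (auto simp: intersection_of_def relative_to_def)
    obtain \<U> where "\<U> \<subseteq> Collect (finite intersection_of (\<lambda>x. x \<in> \<B>) relative_to \<Union>\<B>)"
        and S: "S = \<Union>\<U>"
      using \<open>?P S\<close> by (auto simp: union_of_def)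
    then have "openin (topology_generated_by \<B>) S"
      unfolding S using * by (intro openin_Union) auto
    then show "generate_topology_on \<B> S" by (rule openin_topology_generated_by)
  qed
  then have "?P = generate_topology_on \<B>" by (rule ext)
  then show "topology ?P = topology_generated_by \<B>" by (rule arg_cong)
next
  fix \<C> assume "\<C> \<subseteq> \<B>" "\<Union>\<C> = topspace (topology_generated_by \<B>)"
  then show "\<exists>\<C>'. finite \<C>' \<and> \<C>' \<subseteq> \<C> \<and> \<Union>\<C>' = topspace (topology_generated_by \<B>)"
    unfolding topology_generated_by_topspace by (rule assms)
qed

section \<open>Filters and ideals of a lattice\<close>

definition lattice_filter :: "('a, 'm) gorder_scheme \<Rightarrow> 'a set \<Rightarrow> bool" where
  "lattice_filter L F \<longleftrightarrow> F \<subseteq> carrier L \<and> F \<noteq> {} \<and>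
     (\<forall>x\<in>F. \<forall>y\<in>carrier L. x \<sqsubseteq>\<^bsub>L\<^esub> y \<longrightarrow> y \<in> F) \<and> (\<forall>x\<in>F. \<forall>y\<in>F. x \<sqinter>\<^bsub>L\<^esub> y \<in> F)"

definition lattice_ideal :: "('a, 'm) gorder_scheme \<Rightarrow> 'a set \<Rightarrow> bool" where
  "lattice_ideal L I \<longleftrightarrow> I \<subseteq> carrier L \<and> I \<noteq> {} \<and>
     (\<forall>x\<in>I. \<forall>y\<in>carrier L. y \<sqsubseteq>\<^bsub>L\<^esub> x \<longrightarrow> y \<in> I) \<and> (\<forall>x\<in>I. \<forall>y\<in>I. x \<squnion>\<^bsub>L\<^esub> y \<in> I)"

lemma lattice_filterI:
  assumes "F \<subseteq> carrier L" "F \<noteq> {}"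
    and "\<And>x y. x \<in> F \<Longrightarrow> y \<in> carrier L \<Longrightarrow> x \<sqsubseteq>\<^bsub>L\<^esub> y \<Longrightarrow> y \<in> F"
    and "\<And>x y. x \<in> F \<Longrightarrow> y \<in> F \<Longrightarrow> x \<sqinter>\<^bsub>L\<^esub> y \<in> F"
  shows "lattice_filter L F"
  using assms by (simp add: lattice_filter_def)

lemma lattice_idealI:
  assumes "I \<subseteq> carrier L" "I \<noteq> {}"
    and "\<And>x y. x \<in> I \<Longrightarrow> y \<in> carrier L \<Longrightarrow> y \<sqsubseteq>\<^bsub>L\<^esub> x \<Longrightarrow> y \<in> I"
    and "\<And>x y. x \<in> I \<Longrightarrow> y \<in> I \<Longrightarrow> x \<squnion>\<^bsub>L\<^esub> y \<in> I"
  shows "lattice_ideal L I"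
  using assms by (simp add: lattice_ideal_def)

lemma lattice_filterD:
  assumes "lattice_filter L F"
  shows "F \<subseteq> carrier L" "F \<noteq> {}"
    and "\<And>x y. x \<in> F \<Longrightarrow> y \<in> carrier L \<Longrightarrow> x \<sqsubseteq>\<^bsub>L\<^esub> y \<Longrightarrow> y \<in> F"
    and "\<And>x y. x \<in> F \<Longrightarrow> y \<in> F \<Longrightarrow> x \<sqinter>\<^bsub>L\<^esub> y \<in> F"
  using assms by (simp_all add: lattice_filter_def)

context lattice
begin

lemma meet_mono:
  assumes "a \<sqsubseteq> b" "c \<sqsubseteq> d" "a \<in> carrier L" "b \<in> carrier L" "c \<in> carrier L" "d \<in> carrier L"
  shows "a \<sqinter> c \<sqsubseteq> b \<sqinter> d"
  using assms le_trans[OF meet_left[of a c] assms(1)] le_trans[OF meet_right[of a c] assms(2)]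
  by (simp add: meet_le)

lemma join_mono:
  assumes "a \<sqsubseteq> b" "c \<sqsubseteq> d" "a \<in> carrier L" "b \<in> carrier L" "c \<in> carrier L" "d \<in> carrier L"
  shows "a \<squnion> c \<sqsubseteq> b \<squnion> d"
  using assms le_trans[OF assms(1) join_left[of b d]] le_trans[OF assms(2) join_right[of b d]]
  by (simp add: join_le)

text \<open>The set is the filter generated by \<open>M\<close> and \<open>u\<close>. It serves to
  show that maximal filters are prime, and to find prime filters that refute an implication.\<close>

lemma lattice_filter_extend:
  assumes M: "lattice_filter L M" and u: "u \<in> carrier L"
  shows "lattice_filter L {z \<in> carrier L. \<exists>m\<in>M. m \<sqinter> u \<sqsubseteq> z}"
    and "M \<subseteq> {z \<in> carrier L. \<exists>m\<in>M. m \<sqinter> u \<sqsubseteq> z}"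
    and "u \<in> {z \<in> carrier L. \<exists>m\<in>M. m \<sqinter> u \<sqsubseteq> z}"
proof -
  have sub: "M \<subseteq> carrier L" and ne: "M \<noteq> {}" and meet: "\<And>x y. x \<in> M \<Longrightarrow> y \<in> M \<Longrightarrow> x \<sqinter> y \<in> M"
    using M by (auto simp: lattice_filter_def)
  show 1: "M \<subseteq> {z \<in> carrier L. \<exists>m\<in>M. m \<sqinter> u \<sqsubseteq> z}"
    using sub u meet_left by blast
  show "u \<in> {z \<in> carrier L. \<exists>m\<in>M. m \<sqinter> u \<sqsubseteq> z}"
    using sub u meet_right ne by blast
  show "lattice_filter L {z \<in> carrier L. \<exists>m\<in>M. m \<sqinter> u \<sqsubseteq> z}"
  proof (rule lattice_filterI)
    show "{z \<in> carrier L. \<exists>m\<in>M. m \<sqinter> u \<sqsubseteq> z} \<noteq> {}" using 1 ne by auto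
  next
    fix x y assume "x \<in> {z \<in> carrier L. \<exists>m\<in>M. m \<sqinter> u \<sqsubseteq> z}" and y: "y \<in> carrier L" "x \<sqsubseteq> y"
    then obtain m where m: "m \<in> M" "m \<sqinter> u \<sqsubseteq> x" and x: "x \<in> carrier L" by auto
    have "m \<sqinter> u \<sqsubseteq> y" using le_trans[OF m(2) y(2)] m(1) sub u x y(1) by auto
    then show "y \<in> {z \<in> carrier L. \<exists>m\<in>M. m \<sqinter> u \<sqsubseteq> z}" using m y by auto
  next
    fix x y assume "x \<in> {z \<in> carrier L. \<exists>m\<in>M. m \<sqinter> u \<sqsubseteq> z}" "y \<in> {z \<in> carrier L. \<exists>m\<in>M. m \<sqinter> u \<sqsubseteq> z}"
    then obtain m n where xy: "x \<in> carrier L" "y \<in> carrier L"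
      and m: "m \<in> M" "n \<in> M" "m \<sqinter> u \<sqsubseteq> x" "n \<sqinter> u \<sqsubseteq> y"
      by auto
    have c: "m \<in> carrier L" "n \<in> carrier L" using m sub by auto
    have "(m \<sqinter> n) \<sqinter> u \<sqsubseteq> m \<sqinter> u" "(m \<sqinter> n) \<sqinter> u \<sqsubseteq> n \<sqinter> u"
      by (simp_all add: c u meet_left meet_right meet_mono)
    then have "(m \<sqinter> n) \<sqinter> u \<sqsubseteq> x" "(m \<sqinter> n) \<sqinter> u \<sqsubseteq> y"
      using m c u xy by (meson le_trans meet_closed)+
    then have "(m \<sqinter> n) \<sqinter> u \<sqsubseteq> x \<sqinter> y"
      using c u xy by (simp add: meet_le)
    then show "x \<sqinter> y \<in> {z \<in> carrier L. \<exists>m\<in>M. m \<sqinter> u \<sqsubseteq> z}"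
      using meet[OF m(1,2)] xy by auto
  qed auto
qed

lemma lattice_filter_principal: "u \<in> carrier L \<Longrightarrow> lattice_filter L {z \<in> carrier L. u \<sqsubseteq> z}"
  by (rule lattice_filterI) (auto intro: le_trans meet_le)

lemma lattice_ideal_principal: "u \<in> carrier L \<Longrightarrow> lattice_ideal L {z \<in> carrier L. z \<sqsubseteq> u}"
proof (rule lattice_idealI)
  fix x y assume "u \<in> carrier L" "x \<in> {z \<in> carrier L. z \<sqsubseteq> u}" "y \<in> carrier L" "y \<sqsubseteq> x"
  then show "y \<in> {z \<in> carrier L. z \<sqsubseteq> u}" using le_trans[of y x u] by simp
qed (auto intro: join_le)

end

lemma prime_filterD:
  assumes "P \<in> prime_filters L"
  shows "lattice_filter L P" and "P \<subseteq> carrier L"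
    and "\<And>x y. x \<in> carrier L \<Longrightarrow> y \<in> carrier L \<Longrightarrow> x \<squnion>\<^bsub>L\<^esub> y \<in> P \<Longrightarrow> x \<in> P \<or> y \<in> P"
  using assms by (auto simp: prime_filters_def prime_filter_def lattice_filter_def)

lemma prime_filter_up:
  assumes "P \<in> prime_filters L" "x \<in> P" "y \<in> carrier L" "x \<sqsubseteq>\<^bsub>L\<^esub> y"
  shows "y \<in> P"
  using assms by (auto simp: prime_filters_def prime_filter_def)

section \<open>Prime filter theorem, Stone map and compactness of the dual\<close>

context bounded_distributive_lattice
begin

text \<open>Zorn's lemma gives a filter maximal among those that contain \<open>F\<close> and avoid
  \<open>I\<close>; distributivity makes it prime.\<close>

lemma prime_filter_exists:
  assumes F: "lattice_filter L F" and I: "lattice_ideal L I" and FI: "F \<inter> I = {}"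
  obtains P where "P \<in> prime_filters L" "F \<subseteq> P" "P \<inter> I = {}"
proof -
  let ?A = "{G. lattice_filter L G \<and> F \<subseteq> G \<and> G \<inter> I = {}}"
  have "\<Union>\<C> \<in> ?A" if "\<C> \<noteq> {}" "subset.chain ?A \<C>" for \<C>
  proof -
    have A: "lattice_filter L G" "F \<subseteq> G" "G \<inter> I = {}" if "G \<in> \<C>" for G
      using that \<open>subset.chain ?A \<C>\<close> by (auto simp: subset.chain_def)
    have cmp: "G \<subseteq> G' \<or> G' \<subseteq> G" if "G \<in> \<C>" "G' \<in> \<C>" for G G'
      using that \<open>subset.chain ?A \<C>\<close> by (auto simp: subset_chain_def)
    have "lattice_filter L (\<Union>\<C>)"
    proof (rule lattice_filterI)
      show "\<Union>\<C> \<subseteq> carrier L" using lattice_filterD(1)[OF A(1)] by blast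
      obtain G where "G \<in> \<C>" using \<open>\<C> \<noteq> {}\<close> by blast
      then show "\<Union>\<C> \<noteq> {}" using lattice_filterD(2)[OF A(1)] by blast
    next
      fix x y assume "x \<in> \<Union>\<C>" and y: "y \<in> carrier L" "x \<sqsubseteq> y"
      then obtain G where G: "G \<in> \<C>" "x \<in> G" by blast
      then have "y \<in> G" using lattice_filterD(3)[OF A(1)] y by blast
      then show "y \<in> \<Union>\<C>" using G by blast
    next
      fix x y assume "x \<in> \<Union>\<C>" "y \<in> \<Union>\<C>"
      then obtain G1 G2 where G12: "G1 \<in> \<C>" "x \<in> G1" "G2 \<in> \<C>" "y \<in> G2" by blast
      obtain G where G: "G \<in> \<C>" "x \<in> G" "y \<in> G" using cmp[of G1 G2] G12 by blast
      then have "x \<sqinter> y \<in> G" using lattice_filterD(4)[OF A(1)] by blast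
      then show "x \<sqinter> y \<in> \<Union>\<C>" using G by blast
    qed
    then show ?thesis using A(2,3) \<open>\<C> \<noteq> {}\<close> by blast
  qed
  moreover have "?A \<noteq> {}" using F FI by auto
  ultimately have "\<exists>M\<in>?A. \<forall>G\<in>?A. M \<subseteq> G \<longrightarrow> G = M"
    by (intro subset_Zorn_nonempty)
  then obtain M where M: "M \<in> ?A" and max: "\<forall>G\<in>?A. M \<subseteq> G \<longrightarrow> G = M"
    by (elim bexE)
  have filt: "lattice_filter L M" and disj: "M \<inter> I = {}" using M by auto
  \<comment> \<open>By maximality, the filter generated by \<open>M\<close> and an outside element
    \<open>u\<close> must meet \<open>I\<close>.\<close>
  have ext: "\<exists>m\<in>M. \<exists>i\<in>I. m \<sqinter> u \<sqsubseteq> i" if u: "u \<in> carrier L" "u \<notin> M" for u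
  proof (rule ccontr)
    let ?G = "{z \<in> carrier L. \<exists>m\<in>M. m \<sqinter> u \<sqsubseteq> z}"
    assume "\<not> ?thesis"
    then have "?G \<inter> I = {}" by blast
    then have "?G \<in> ?A"
      using lattice_filter_extend(1,2)[OF filt u(1)] M by auto
    then have "?G = M"
      using max[rule_format, of ?G] lattice_filter_extend(2)[OF filt u(1)] by simp
    then show False using lattice_filter_extend(3)[OF filt u(1)] u(2) by simp
  qed
  have "x \<in> M \<or> y \<in> M" if xy: "x \<in> carrier L" "y \<in> carrier L" "x \<squnion> y \<in> M" for x y
  proof (rule ccontr)
    assume "\<not> ?thesis"
    then obtain m n i j where mn: "m \<in> M" "n \<in> M" and ij: "i \<in> I" "j \<in> I"
      and le: "m \<sqinter> x \<sqsubseteq> i" "n \<sqinter> y \<sqsubseteq> j"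
      using ext[OF xy(1)] ext[OF xy(2)] by auto
    have c: "m \<in> carrier L" "n \<in> carrier L" "i \<in> carrier L" "j \<in> carrier L"
      using mn ij filt I by (auto simp: lattice_filter_def lattice_ideal_def)
    \<comment> \<open>Below \<open>m\<close> and \<open>n\<close> both witnesses apply at once;
      distributing \<open>?k\<close> over \<open>x \<squnion> y\<close> then forces
      \<open>i \<squnion> j\<close>, an element of \<open>I\<close>, into \<open>M\<close>.\<close>
    let ?k = "m \<sqinter> n"
    have "?k \<sqinter> (x \<squnion> y) = (?k \<sqinter> x) \<squnion> (?k \<sqinter> y)" using c xy meet_join_distrib by simp
    also have "\<dots> \<sqsubseteq> i \<squnion> j"
    proof -
      have "?k \<sqinter> x \<sqsubseteq> m \<sqinter> x" "?k \<sqinter> y \<sqsubseteq> n \<sqinter> y"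
        by (simp_all add: c xy meet_left meet_right meet_mono)
      then have "?k \<sqinter> x \<sqsubseteq> i" "?k \<sqinter> y \<sqsubseteq> j"
        using le c xy by (meson le_trans meet_closed)+
      then show ?thesis using c xy by (simp add: join_mono)
    qed
    finally have "i \<squnion> j \<in> M"
      using lattice_filterD(3)[OF filt _ join_closed[OF c(3,4)]]
        lattice_filterD(4)[OF filt lattice_filterD(4)[OF filt mn] xy(3)] by simp
    moreover have "i \<squnion> j \<in> I" using I ij by (auto simp: lattice_ideal_def)
    ultimately show False using disj by blast
  qed
  moreover have "M \<noteq> carrier L" using disj I by (auto simp: lattice_ideal_def)
  ultimately have "M \<in> prime_filters L"
    using filt by (auto simp: lattice_filter_def prime_filters_def prime_filter_def)
  then show thesis using that M by blast
qed

lemma prime_filter_top: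
  assumes "P \<in> prime_filters L"
  shows "\<top> \<in> P"
proof -
  obtain x where "x \<in> P" using lattice_filterD(2)[OF prime_filterD(1)[OF assms]] by blast
  moreover from this have "x \<in> carrier L" using prime_filterD(2)[OF assms] by blast
  ultimately show ?thesis using prime_filter_up[OF assms _ top_closed] by blast
qed

lemma prime_filter_bottom: "P \<in> prime_filters L \<Longrightarrow> \<bottom> \<notin> P"
  unfolding prime_filters_def prime_filter_def by blast

lemma stone_map_subset: "stone_map L a \<subseteq> prime_filters L"
  by (auto simp: stone_map_def)

lemma stone_map_top: "stone_map L \<top> = prime_filters L"
  using prime_filter_top by (auto simp: stone_map_def)

lemma stone_map_bottom: "stone_map L \<bottom> = {}"
  using prime_filter_bottom by (auto simp: stone_map_def)

lemma stone_map_meet: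
  assumes "x \<in> carrier L" "y \<in> carrier L"
  shows "stone_map L (x \<sqinter> y) = stone_map L x \<inter> stone_map L y"
proof -
  have "x \<sqinter> y \<in> P \<longleftrightarrow> x \<in> P \<and> y \<in> P" if P: "P \<in> prime_filters L" for P
    using prime_filter_up[OF P _ _ meet_left[OF assms]] prime_filter_up[OF P _ _ meet_right[OF assms]]
      lattice_filterD(4)[OF prime_filterD(1)[OF P], of x y] assms by auto
  then show ?thesis by (auto simp: stone_map_def)
qed

lemma stone_map_join:
  assumes "x \<in> carrier L" "y \<in> carrier L"
  shows "stone_map L (x \<squnion> y) = stone_map L x \<union> stone_map L y"
proof -
  have "x \<squnion> y \<in> P \<longleftrightarrow> x \<in> P \<or> y \<in> P" if P: "P \<in> prime_filters L" for P
    using prime_filter_up[OF P _ _ join_left[OF assms]] prime_filter_up[OF P _ _ join_right[OF assms]]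
      prime_filterD(3)[OF P assms] assms by auto
  then show ?thesis by (auto simp: stone_map_def)
qed

text \<open>If \<open>x\<close> is not below \<open>y\<close>, the principal filter of
  \<open>x\<close> and the principal ideal of \<open>y\<close> are disjoint, and a prime filter
  separates them. Injectivity of the Stone map follows.\<close>

lemma stone_map_le_iff:
  assumes "x \<in> carrier L" "y \<in> carrier L"
  shows "stone_map L x \<subseteq> stone_map L y \<longleftrightarrow> x \<sqsubseteq> y"
proof
  assume "x \<sqsubseteq> y"
  then show "stone_map L x \<subseteq> stone_map L y"
    using prime_filter_up[OF _ _ assms(2), of _ x] by (auto simp: stone_map_def)
next
  assume sub: "stone_map L x \<subseteq> stone_map L y"
  show "x \<sqsubseteq> y"
  proof (rule ccontr)
    assume "\<not> x \<sqsubseteq> y"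
    then have "{z \<in> carrier L. x \<sqsubseteq> z} \<inter> {z \<in> carrier L. z \<sqsubseteq> y} = {}"
      using assms le_trans[of x _ y] by auto
    then obtain P where P: "P \<in> prime_filters L" "{z \<in> carrier L. x \<sqsubseteq> z} \<subseteq> P"
        "P \<inter> {z \<in> carrier L. z \<sqsubseteq> y} = {}"
      by (rule prime_filter_exists[OF lattice_filter_principal[OF assms(1)]
          lattice_ideal_principal[OF assms(2)]])
    have "x \<in> P" "y \<notin> P" using P assms by auto
    with P(1) have "P \<in> stone_map L x" "P \<notin> stone_map L y" by (auto simp: stone_map_def)
    then show False using sub by blast
  qed
qed

lemma inj_on_stone_map: "inj_on (stone_map L) (carrier L)"
  by (rule inj_onI) (metis le_antisym order_refl stone_map_le_iff)

lemma topspace_dual [simp]: "topspace (dual_topology L) = prime_filters L"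
  using stone_map_subset stone_map_top by (auto simp: dual_topology_def)

lemma clopenin_stone_map:
  assumes "a \<in> carrier L"
  shows "clopenin (dual_topology L) (stone_map L a)"
proof -
  have "openin (dual_topology L) (stone_map L a)"
       "openin (dual_topology L) (prime_filters L - stone_map L a)"
    unfolding dual_topology_def using assms by (auto intro!: topology_generated_by_Basis)
  then show ?thesis using stone_map_subset by (auto simp: clopenin_def closedin_def)
qed

lemma compact_space_dual: "compact_space (dual_topology L)"
  unfolding dual_topology_def
proof (rule compact_space_topology_generated_by)
  let ?B = "stone_map L ` carrier L \<union> (\<lambda>a. prime_filters L - stone_map L a) ` carrier L"
  have UB: "\<Union>?B = prime_filters L"
  proof
    show "\<Union>?B \<subseteq> prime_filters L" using stone_map_subset by auto
    have "stone_map L \<top> \<in> ?B" by simp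
    then show "prime_filters L \<subseteq> \<Union>?B" unfolding stone_map_top by (rule Union_upper)
  qed
  fix \<C> assume \<C>: "\<C> \<subseteq> ?B" "\<Union>\<C> = \<Union>?B"
  define S where "S = {a \<in> carrier L. stone_map L a \<in> \<C>}"
  define T where "T = {a \<in> carrier L. prime_filters L - stone_map L a \<in> \<C>}"
  txt \<open>A common element of \<open>F\<close> and \<open>I\<close> yields a finite subcover; if there were none, a prime
    filter separating \<open>F\<close> from \<open>I\<close> would not be covered at all.\<close>
  define F where "F = {x \<in> carrier L. \<exists>T'. finite T' \<and> T' \<subseteq> T \<and>
      prime_filters L \<inter> \<Inter>(stone_map L ` T') \<subseteq> stone_map L x}"
  define I where "I = {x \<in> carrier L. \<exists>S'. finite S' \<and> S' \<subseteq> S \<and>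
      stone_map L x \<subseteq> \<Union>(stone_map L ` S')}"
  have "lattice_filter L F"
  proof (rule lattice_filterI)
    show "F \<subseteq> carrier L" by (auto simp: F_def)
    have "\<top> \<in> F" unfolding F_def using stone_map_top by (auto intro!: exI[of _ "{}"])
    then show "F \<noteq> {}" by blast
    fix x y assume x: "x \<in> F" and y: "y \<in> carrier L" "x \<sqsubseteq> y"
    then have "stone_map L x \<subseteq> stone_map L y" using stone_map_le_iff by (simp add: F_def)
    then show "y \<in> F" using x y unfolding F_def by blast
  next
    fix x y assume "x \<in> F" "y \<in> F"
    then obtain T1 T2 where "finite T1" "T1 \<subseteq> T" "prime_filters L \<inter> \<Inter>(stone_map L ` T1) \<subseteq> stone_map L x"
       "finite T2" "T2 \<subseteq> T" "prime_filters L \<inter> \<Inter>(stone_map L ` T2) \<subseteq> stone_map L y"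
       "x \<in> carrier L" "y \<in> carrier L" unfolding F_def by blast
    then show "x \<sqinter> y \<in> F" unfolding F_def
      by (intro CollectI conjI exI[of _ "T1 \<union> T2"]) (auto simp: stone_map_meet)
  qed
  moreover have "lattice_ideal L I"
  proof (rule lattice_idealI)
    show "I \<subseteq> carrier L" by (auto simp: I_def)
    have "\<bottom> \<in> I" unfolding I_def using stone_map_bottom by (auto intro!: exI[of _ "{}"])
    then show "I \<noteq> {}" by blast
    fix x y assume x: "x \<in> I" and y: "y \<in> carrier L" "y \<sqsubseteq> x"
    then have "stone_map L y \<subseteq> stone_map L x" using stone_map_le_iff by (simp add: I_def)
    then show "y \<in> I" using x y unfolding I_def by blast
  next
    fix x y assume "x \<in> I" "y \<in> I"
    then obtain S1 S2 where "finite S1" "S1 \<subseteq> S" "stone_map L x \<subseteq> \<Union>(stone_map L ` S1)"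
       "finite S2" "S2 \<subseteq> S" "stone_map L y \<subseteq> \<Union>(stone_map L ` S2)"
       "x \<in> carrier L" "y \<in> carrier L" unfolding I_def by blast
    then show "x \<squnion> y \<in> I" unfolding I_def
      by (intro CollectI conjI exI[of _ "S1 \<union> S2"]) (auto simp: stone_map_join)
  qed
  moreover have "F \<inter> I \<noteq> {}"
  proof
    assume "F \<inter> I = {}"
    then obtain P where P: "P \<in> prime_filters L" "F \<subseteq> P" "P \<inter> I = {}"
      using prime_filter_exists[OF calculation] by blast
    have "T \<subseteq> P"
    proof
      fix x assume "x \<in> T"
      then have "x \<in> F" unfolding F_def T_def by (auto intro!: exI[of _ "{x}"])
      then show "x \<in> P" using P by blast
    qed
    moreover have "P \<inter> S = {}"
    proof -
      have "S \<subseteq> I" unfolding I_def S_def by (auto intro!: exI[of _ "{x}" for x])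
      then show ?thesis using P by blast
    qed
    moreover have "P \<in> \<Union>\<C>" unfolding \<C>(2) UB by (rule P(1))
    then obtain C where C: "C \<in> \<C>" "P \<in> C" by (rule UnionE)
    moreover have "C \<in> ?B" using C(1) \<C>(1) by (rule rev_subsetD)
    then obtain a where "a \<in> carrier L" "C = stone_map L a \<or> C = prime_filters L - stone_map L a"
      by auto
    ultimately show False
      using P(1) by (auto simp: S_def T_def stone_map_def)
  qed
  then obtain x T' S' where fin: "finite T'" "T' \<subseteq> T" "finite S'" "S' \<subseteq> S"
    and sub: "prime_filters L \<inter> \<Inter>(stone_map L ` T') \<subseteq> stone_map L x"
      "stone_map L x \<subseteq> \<Union>(stone_map L ` S')"
    unfolding F_def I_def by blast
  show "\<exists>\<C>'. finite \<C>' \<and> \<C>' \<subseteq> \<C> \<and> \<Union>\<C>' = \<Union>?B"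
  proof (intro exI conjI)
    let ?C = "(\<lambda>a. prime_filters L - stone_map L a) ` T' \<union> stone_map L ` S'"
    show "finite ?C" using fin by simp
    show "?C \<subseteq> \<C>" using fin by (auto simp: S_def T_def)
    show "\<Union>?C = \<Union>?B" unfolding UB
    proof
      show "\<Union>?C \<subseteq> prime_filters L" using stone_map_subset by auto
      show "prime_filters L \<subseteq> \<Union>?C" using sub by auto
    qed
  qed
qed

end

section \<open>Priestley spaces\<close>

lemma clopenin_Un: "clopenin T U \<Longrightarrow> clopenin T V \<Longrightarrow> clopenin T (U \<union> V)"
  and clopenin_Int: "clopenin T U \<Longrightarrow> clopenin T V \<Longrightarrow> clopenin T (U \<inter> V)"
  and clopenin_Diff: "clopenin T U \<Longrightarrow> clopenin T V \<Longrightarrow> clopenin T (U - V)"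
  and clopenin_topspace: "clopenin T (topspace T)"
  and clopenin_empty: "clopenin T {}"
  by (auto simp: clopenin_def openin_diff closedin_diff closedin_Un)

lemmas clopenin_intros = clopenin_Un clopenin_Int clopenin_Diff clopenin_topspace clopenin_empty

lemma clopenin_subset: "clopenin T U \<Longrightarrow> U \<subseteq> topspace T"
  by (simp add: clopenin_def openin_subset)

lemma upset_of_Un: "upset_of A r U \<Longrightarrow> upset_of A r V \<Longrightarrow> upset_of A r (U \<union> V)"
  and upset_of_Int: "upset_of A r U \<Longrightarrow> upset_of A r V \<Longrightarrow> upset_of A r (U \<inter> V)"
  and upset_of_self: "upset_of A r A"
  and upset_of_empty: "upset_of A r {}"
  unfolding upset_of_def by blast+

lemma upset_ofD: "upset_of A r U \<Longrightarrow> x \<in> U \<Longrightarrow> y \<in> A \<Longrightarrow> (x, y) \<in> r \<Longrightarrow> y \<in> U"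
  unfolding upset_of_def by blast

section \<open>Separation by compactness\<close>

text \<open>The finite intersection property for a family closed under binary intersections:
  finitely many members already exclude all of \<open>G\<close>, and a single member lies below
  them.\<close>

lemma compactin_avoid:
  assumes G: "compactin T G"
    and cl: "\<And>U. U \<in> \<V> \<Longrightarrow> closedin T U" and ne: "\<V> \<noteq> {}"
    and Int: "\<And>U V. U \<in> \<V> \<Longrightarrow> V \<in> \<V> \<Longrightarrow> U \<inter> V \<in> \<V>"
    and sep: "\<And>y. y \<in> G \<Longrightarrow> \<exists>U\<in>\<V>. y \<notin> U"
  shows "\<exists>U\<in>\<V>. U \<inter> G = {}"
proof -
  let ?\<U> = "(\<lambda>U. topspace T - U) ` \<V>"
  have GT: "G \<subseteq> topspace T" using G by (rule compactin_subset_topspace)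
  have "G \<subseteq> \<Union>?\<U>"
  proof
    fix y assume "y \<in> G"
    then show "y \<in> \<Union>?\<U>" using sep[of y] GT by auto
  qed
  moreover have "\<forall>U\<in>?\<U>. openin T U" using cl by auto
  ultimately obtain \<F> where \<F>: "finite \<F>" "\<F> \<subseteq> ?\<U>" "G \<subseteq> \<Union>\<F>"
    using G unfolding compactin_def by meson
  then obtain \<W> where \<W>: "finite \<W>" "\<W> \<subseteq> \<V>" "\<F> = (\<lambda>U. topspace T - U) ` \<W>"
    using finite_subset_image by metis
  have "\<exists>U\<in>\<V>. U \<subseteq> \<Inter>\<W>" using \<W>(1,2)
  proof (induction \<W>)
    case empty
    then show ?case using ne by auto
  next
    case (insert W \<W>)
    then obtain U where "U \<in> \<V>" "U \<subseteq> \<Inter>\<W>" by auto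
    then show ?case using Int[of W U] insert.prems by (intro bexI[of _ "W \<inter> U"]) auto
  qed
  then obtain U where "U \<in> \<V>" "U \<subseteq> \<Inter>\<W>" by auto
  then show ?thesis using \<F>(3) unfolding \<W>(3) by (intro bexI[of _ U]) auto
qed

text \<open>Two uses of \<open>compactin_avoid\<close>: members of \<open>\<A>\<close> around a
  fixed \<open>x\<close> shrink until they miss \<open>G\<close>, then complements of members
  missing \<open>G\<close> shrink until they miss \<open>F\<close>. Applied to a clopen set and its
  complement, the lemma shows that the set itself belongs to \<open>\<A>\<close>.\<close>

lemma compactin_separation:
  assumes F: "compactin T F" and G: "compactin T G"
    and clopen: "\<And>U. U \<in> \<A> \<Longrightarrow> clopenin T U"
    and Un: "\<And>U V. U \<in> \<A> \<Longrightarrow> V \<in> \<A> \<Longrightarrow> U \<union> V \<in> \<A>"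
    and Int: "\<And>U V. U \<in> \<A> \<Longrightarrow> V \<in> \<A> \<Longrightarrow> U \<inter> V \<in> \<A>"
    and "{} \<in> \<A>" "topspace T \<in> \<A>"
    and sep: "\<And>x y. x \<in> F \<Longrightarrow> y \<in> G \<Longrightarrow> \<exists>U\<in>\<A>. x \<in> U \<and> y \<notin> U"
  obtains U where "U \<in> \<A>" "F \<subseteq> U" "U \<inter> G = {}"
proof -
  have FT: "F \<subseteq> topspace T" using F by (rule compactin_subset_topspace)
  let ?\<V> = "(\<lambda>U. topspace T - U) ` {U \<in> \<A>. U \<inter> G = {}}"
  have "\<exists>W\<in>?\<V>. W \<inter> F = {}"
  proof (rule compactin_avoid[OF F])
    show "closedin T U" if "U \<in> ?\<V>" for U using that clopen by (auto simp: clopenin_def)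
    show "?\<V> \<noteq> {}" using \<open>{} \<in> \<A>\<close> by auto
    show "U \<inter> V \<in> ?\<V>" if UV: "U \<in> ?\<V>" "V \<in> ?\<V>" for U V
    proof -
      obtain U' V' where "U' \<in> \<A>" "V' \<in> \<A>" "U' \<inter> G = {}" "V' \<inter> G = {}"
        "U = topspace T - U'" "V = topspace T - V'" using UV by auto
      then show ?thesis using Un by (intro image_eqI[of _ _ "U' \<union> V'"]) auto
    qed
    fix x assume x: "x \<in> F"
    have "\<exists>U\<in>{U \<in> \<A>. x \<in> U}. U \<inter> G = {}"
    proof (rule compactin_avoid[OF G])
      show "closedin T U" if "U \<in> {U \<in> \<A>. x \<in> U}" for U using that clopen by (auto simp: clopenin_def)
      show "{U \<in> \<A>. x \<in> U} \<noteq> {}" using x FT \<open>topspace T \<in> \<A>\<close> by auto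
      show "U \<inter> V \<in> {U \<in> \<A>. x \<in> U}" if "U \<in> {U \<in> \<A>. x \<in> U}" "V \<in> {U \<in> \<A>. x \<in> U}" for U V
        using that Int by auto
      show "\<exists>U\<in>{U \<in> \<A>. x \<in> U}. y \<notin> U" if "y \<in> G" for y
        using sep[OF x that] by auto
    qed
    then show "\<exists>W\<in>?\<V>. x \<notin> W" by auto
  qed
  then show thesis using that FT by auto
qed

section \<open>Consequences of the Priestley axiom\<close>

locale priestley =
  fixes T :: "'a topology" and r :: "('a \<times> 'a) set"
  assumes priestley: "priestley_space T r"
begin

lemma compact: "compact_space T"
  and r_subset: "(x, y) \<in> r \<Longrightarrow> x \<in> topspace T \<and> y \<in> topspace T"
  and r_refl: "x \<in> topspace T \<Longrightarrow> (x, x) \<in> r"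
  and r_trans: "(x, y) \<in> r \<Longrightarrow> (y, z) \<in> r \<Longrightarrow> (x, z) \<in> r"
  and r_antisym: "(x, y) \<in> r \<Longrightarrow> (y, x) \<in> r \<Longrightarrow> x = y"
  using priestley
  by (auto simp: priestley_space_def partial_order_on_def preorder_on_def refl_on_def antisym_def
      elim: transE)

definition clopen_upsets :: "'a set set" where
  "clopen_upsets = {U. clopenin T U \<and> upset_of (topspace T) r U}"

lemma clopen_upsets_Un: "U \<in> clopen_upsets \<Longrightarrow> V \<in> clopen_upsets \<Longrightarrow> U \<union> V \<in> clopen_upsets"
  and clopen_upsets_Int: "U \<in> clopen_upsets \<Longrightarrow> V \<in> clopen_upsets \<Longrightarrow> U \<inter> V \<in> clopen_upsets"
  and clopen_upsets_empty: "{} \<in> clopen_upsets"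
  and clopen_upsets_topspace: "topspace T \<in> clopen_upsets"
  by (simp_all add: clopen_upsets_def clopenin_intros upset_of_Un upset_of_Int upset_of_empty upset_of_self)

lemma clopen_upsets_clopen: "U \<in> clopen_upsets \<Longrightarrow> clopenin T U"
  by (simp add: clopen_upsets_def)

lemma clopen_upsets_up: "U \<in> clopen_upsets \<Longrightarrow> x \<in> U \<Longrightarrow> (x, y) \<in> r \<Longrightarrow> y \<in> U"
  using r_subset upset_ofD[of "topspace T" r U x y] by (auto simp: clopen_upsets_def)

lemma clopen_upsets_separates:
  assumes "x \<in> topspace T" "y \<in> topspace T" "(x, y) \<notin> r"
  obtains U where "U \<in> clopen_upsets" "x \<in> U" "y \<notin> U"
  using assms priestley unfolding priestley_space_def clopen_upsets_def by blast

text \<open>Compactness extends the axiom from points to closed sets. This supplies the clopen upset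
  that cuts chains in \<open>openin_cc_downset\<close>.\<close>

lemma closed_separation:
  assumes "closedin T F" "closedin T G" and sep: "\<And>x y. x \<in> F \<Longrightarrow> y \<in> G \<Longrightarrow> (x, y) \<notin> r"
  obtains U where "U \<in> clopen_upsets" "F \<subseteq> U" "U \<inter> G = {}"
proof (rule compactin_separation[of T F G clopen_upsets])
  show "compactin T F" "compactin T G" using assms compact closedin_compact_space by auto
  fix x y assume "x \<in> F" "y \<in> G"
  then have "(x, y) \<notin> r" "x \<in> topspace T" "y \<in> topspace T"
    using sep assms(1,2)[THEN closedin_subset] by auto
  then show "\<exists>U\<in>clopen_upsets. x \<in> U \<and> y \<notin> U" using clopen_upsets_separates by blast
qed (use clopen_upsets_Un clopen_upsets_Int clopen_upsets_empty clopen_upsets_topspace clopen_upsets_clopen that in auto)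

text \<open>A point below no element of \<open>F\<close> has, by compactness, a clopen upset around
  it that misses \<open>F\<close>, and such an upset misses the whole downset.\<close>

lemma closedin_downset:
  assumes F: "closedin T F"
  shows "closedin T (r\<inverse> `` F)"
proof -
  have "openin T (topspace T - r\<inverse> `` F)"
  proof (subst openin_subopen, rule ballI)
    fix x assume x: "x \<in> topspace T - r\<inverse> `` F"
    have "\<exists>U\<in>{U \<in> clopen_upsets. x \<in> U}. U \<inter> F = {}"
    proof (rule compactin_avoid)
      show "compactin T F" using F compact closedin_compact_space by auto
      fix y assume y: "y \<in> F"
      then have "(x, y) \<notin> r" "y \<in> topspace T" using x closedin_subset[OF F] by auto
      then show "\<exists>U\<in>{U \<in> clopen_upsets. x \<in> U}. y \<notin> U" using x clopen_upsets_separates[of x y] by blast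
    qed (use x clopen_upsets_Int clopen_upsets_topspace clopen_upsets_clopen in \<open>auto simp: clopenin_def\<close>)
    then obtain U where U: "U \<in> clopen_upsets" "x \<in> U" "U \<inter> F = {}" by auto
    have "U \<subseteq> topspace T - r\<inverse> `` F"
    proof
      fix z assume z: "z \<in> U"
      have "z \<notin> r\<inverse> `` F"
      proof
        assume "z \<in> r\<inverse> `` F"
        then obtain y where "y \<in> F" "(z, y) \<in> r" by auto
        then show False using clopen_upsets_up[OF U(1) z] U(3) by auto
      qed
      then show "z \<in> topspace T - r\<inverse> `` F" using z clopenin_subset[OF clopen_upsets_clopen[OF U(1)]] by auto
    qed
    then show "\<exists>W. openin T W \<and> x \<in> W \<and> W \<subseteq> topspace T - r\<inverse> `` F"
      using U clopen_upsets_clopen[OF U(1)] by (auto simp: clopenin_def)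
  qed
  moreover have "r\<inverse> `` F \<subseteq> topspace T" using r_subset by auto
  ultimately show ?thesis by (simp add: closedin_def)
qed

text \<open>Each \<open>y\<close> not above \<open>x\<close> is excluded by a clopen upset
  containing \<open>x\<close>. The result makes the part of a closed chain above one of its points a
  closed chain, and the set of prime filters above a given one closed.\<close>

lemma closedin_principal_upset: "closedin T (r `` {x})"
proof -
  have "openin T (topspace T - r `` {x})"
  proof (cases "x \<in> topspace T")
    case x: True
    show ?thesis
    proof (subst openin_subopen, rule ballI)
      fix y assume y: "y \<in> topspace T - r `` {x}"
      then obtain U where U: "U \<in> clopen_upsets" "x \<in> U" "y \<notin> U" using clopen_upsets_separates[OF x, of y] by auto
      have "openin T (topspace T - U)" using clopen_upsets_clopen[OF U(1)] by (auto simp: clopenin_def)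
      moreover have "topspace T - U \<subseteq> topspace T - r `` {x}" using clopen_upsets_up[OF U(1,2)] by auto
      ultimately show "\<exists>W. openin T W \<and> y \<in> W \<and> W \<subseteq> topspace T - r `` {x}"
        using U y by (intro exI[of _ "topspace T - U"]) auto
    qed
  next
    case False
    then have "r `` {x} = {}" using r_subset by auto
    then show ?thesis by simp
  qed
  moreover have "r `` {x} \<subseteq> topspace T" using r_subset by auto
  ultimately show ?thesis by (simp add: closedin_def)
qed

text \<open>By antisymmetry each \<open>y\<close> in \<open>D\<close> fails
  \<open>c \<le> y\<close>, and some clopen upset \<open>U\<close> around \<open>c\<close> omits
  \<open>y\<close>, or fails \<open>y \<le> c\<close>, and some clopen upset \<open>V\<close>
  omitting \<open>c\<close> absorbs \<open>y\<close>. Differences of clopen upsets are closed under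
  intersection, so compactness finishes.\<close>

lemma point_separation:
  assumes D: "closedin T D" and c: "c \<in> topspace T" "c \<notin> D"
  obtains U V where "U \<in> clopen_upsets" "V \<in> clopen_upsets" "c \<in> U - V" "(U - V) \<inter> D = {}"
proof -
  let ?\<V> = "{U - V | U V. U \<in> clopen_upsets \<and> V \<in> clopen_upsets \<and> c \<in> U \<and> c \<notin> V}"
  have "\<exists>W\<in>?\<V>. W \<inter> D = {}"
  proof (rule compactin_avoid)
    show "compactin T D" using D compact closedin_compact_space by auto
    show "closedin T W" if "W \<in> ?\<V>" for W
      using that clopen_upsets_clopen clopenin_Diff by (auto simp: clopenin_def)
    show "?\<V> \<noteq> {}" using c clopen_upsets_topspace clopen_upsets_empty by blast
    show "W \<inter> W' \<in> ?\<V>" if W: "W \<in> ?\<V>" "W' \<in> ?\<V>" for W W'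
    proof -
      obtain U V U' V' where UV: "U \<in> clopen_upsets" "V \<in> clopen_upsets" "c \<in> U" "c \<notin> V" "U' \<in> clopen_upsets" "V' \<in> clopen_upsets" "c \<in> U'" "c \<notin> V'"
        "W = U - V" "W' = U' - V'" using W by blast
      then have "W \<inter> W' = (U \<inter> U') - (V \<union> V')" by auto
      then show ?thesis using UV clopen_upsets_Int[of U U'] clopen_upsets_Un[of V V'] by blast
    qed
    fix y assume y: "y \<in> D"
    then have yT: "y \<in> topspace T" using closedin_subset[OF D] by auto
    have "(c, y) \<notin> r \<or> (y, c) \<notin> r" using r_antisym[of c y] c y by auto
    then show "\<exists>W\<in>?\<V>. y \<notin> W"
    proof
      assume "(c, y) \<notin> r"
      then obtain U where "U \<in> clopen_upsets" "c \<in> U" "y \<notin> U" using clopen_upsets_separates[OF c(1) yT] by auto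
      then have "U - {} \<in> ?\<V>" "y \<notin> U - {}" using clopen_upsets_empty by blast+
      then show ?thesis by blast
    next
      assume "(y, c) \<notin> r"
      then obtain V where "V \<in> clopen_upsets" "y \<in> V" "c \<notin> V" using clopen_upsets_separates[OF yT c(1)] by auto
      then have "topspace T - V \<in> ?\<V>" "y \<notin> topspace T - V" using clopen_upsets_topspace c by blast+
      then show ?thesis by blast
    qed
  qed
  then show thesis using that by blast
qed

text \<open>Needed later so that the compact image of a closed set of prime filters is
  closed.\<close>

lemma Hausdorff: "Hausdorff_space T"
  unfolding Hausdorff_space_def
proof (intro allI impI)
  have *: "\<exists>U V. openin T U \<and> openin T V \<and> x \<in> U \<and> y \<in> V \<and> disjnt U V"
    if xy: "x \<in> topspace T" "y \<in> topspace T" "(x, y) \<notin> r" for x y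
  proof -
    obtain U where U: "U \<in> clopen_upsets" "x \<in> U" "y \<notin> U" using clopen_upsets_separates[OF xy] by blast
    have "openin T U" "openin T (topspace T - U)"
      using clopen_upsets_clopen[OF U(1)] by (auto simp: clopenin_def)
    then show ?thesis
      using U xy by (intro exI[of _ U] exI[of _ "topspace T - U"]) (auto simp: disjnt_def)
  qed
  fix x y assume xy: "x \<in> topspace T \<and> y \<in> topspace T \<and> x \<noteq> y"
  then have "(x, y) \<notin> r \<or> (y, x) \<notin> r" using r_antisym[of x y] by blast
  then show "\<exists>U V. openin T U \<and> openin T V \<and> x \<in> U \<and> y \<in> V \<and> disjnt U V"
  proof
    assume "(x, y) \<notin> r"
    then show ?thesis using *[of x y] xy by blast
  next
    assume "(y, x) \<notin> r"
    then obtain U V where "openin T U" "openin T V" "y \<in> U" "x \<in> V" "disjnt U V"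
      using *[of y x] xy by blast
    then show ?thesis using disjnt_sym by blast
  qed
qed

end

section \<open>The space of closed chains\<close>

lemma closed_chains_UNIV: "closed_chains T UNIV = {C. C \<noteq> {} \<and> closedin T C}"
  by (auto simp: closed_chains_def Chains_def)

lemma closed_chains_subset: "C \<in> closed_chains T r \<Longrightarrow> C \<subseteq> topspace T"
  by (simp add: closed_chains_def closedin_subset)

lemma cc_box_topspace: "cc_box T r (topspace T) = closed_chains T r"
  using closed_chains_subset by (auto simp: cc_box_def)

lemma cc_subbasis_Union:
  "\<Union>(cc_box T r ` {V. clopenin T V} \<union> cc_diamond T r ` {V. clopenin T V}) = closed_chains T r"
proof
  have "cc_box T r (topspace T) \<in> cc_box T r ` {V. clopenin T V}"
    using clopenin_topspace by blast
  then show "closed_chains T r \<subseteq> \<Union>(cc_box T r ` {V. clopenin T V} \<union> cc_diamond T r ` {V. clopenin T V})"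
    unfolding cc_box_topspace by auto
qed (auto simp: cc_box_def cc_diamond_def)

lemma topspace_cc [simp]: "topspace (cc_topology T r) = closed_chains T r"
  unfolding cc_topology_def topology_generated_by_topspace by (rule cc_subbasis_Union)

lemma openin_cc_box: "clopenin T V \<Longrightarrow> openin (cc_topology T r) (cc_box T r V)"
  and openin_cc_diamond: "clopenin T V \<Longrightarrow> openin (cc_topology T r) (cc_diamond T r V)"
  unfolding cc_topology_def by (auto intro!: topology_generated_by_Basis)

lemma cc_box_compl: "V \<subseteq> topspace T \<Longrightarrow> closed_chains T r - cc_box T r V = cc_diamond T r (topspace T - V)"
  and cc_diamond_compl: "closed_chains T r - cc_diamond T r V = cc_box T r (topspace T - V)"
  using closed_chains_subset[of _ T r] by (auto simp: cc_box_def cc_diamond_def)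

lemma clopenin_cc_box: "clopenin T V \<Longrightarrow> clopenin (cc_topology T r) (cc_box T r V)"
  using openin_cc_diamond[of T "topspace T - V" r] openin_cc_box[of T V r] clopenin_subset[of T V]
    clopenin_Diff[OF clopenin_topspace, of T V] openin_subset[of "cc_topology T r"]
  by (auto simp: clopenin_def[of "cc_topology T r"] closedin_def cc_box_compl)

lemma clopenin_cc_diamond: "clopenin T V \<Longrightarrow> clopenin (cc_topology T r) (cc_diamond T r V)"
  using openin_cc_diamond[of T V r] openin_cc_box[of T "topspace T - V" r]
    clopenin_Diff[OF clopenin_topspace, of T V] openin_subset[of "cc_topology T r"]
  by (auto simp: clopenin_def[of "cc_topology T r"] closedin_def cc_diamond_compl)

text \<open>With the full relation, \<open>closed_chains T UNIV\<close> is the Vietoris hyperspace of all nonempty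
  closed sets.\<close>

lemma compact_space_vietoris:
  assumes T: "compact_space T"
  shows "compact_space (cc_topology T UNIV)"
  unfolding cc_topology_def
proof (rule compact_space_topology_generated_by)
  let ?box = "cc_box T UNIV" and ?dia = "cc_diamond T UNIV"
  let ?B = "?box ` {V. clopenin T V} \<union> ?dia ` {V. clopenin T V}"
  fix \<C> assume \<C>: "\<C> \<subseteq> ?B" "\<Union>\<C> = \<Union>?B"
  have UB: "\<Union>?B = closed_chains T UNIV" by (rule cc_subbasis_Union)
  define \<W> where "\<W> = {W. clopenin T W \<and> ?dia W \<in> \<C>}"
  \<comment> \<open>\<open>F\<close> is the largest closed set outside all diamonds of the cover. If
    nonempty, it is a point of the hyperspace, so the cover has a box of some \<open>V\<close>
    containing it, and \<open>V\<close> together with \<open>\<W>\<close> covers the base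
    space.\<close>
  define F where "F = topspace T - \<Union>\<W>"
  have \<W>op: "\<forall>W\<in>\<W>. openin T W" by (auto simp: \<W>_def clopenin_def)
  have \<C>sub: "\<Union>\<C> = closed_chains T UNIV" using \<C>(2) UB by simp
  have "\<exists>\<D> \<W>'. finite \<D> \<and> \<D> \<subseteq> \<C> \<and> finite \<W>' \<and> \<W>' \<subseteq> \<W> \<and>
      (\<forall>C\<in>closed_chains T UNIV. C \<in> \<Union>\<D> \<or> \<not> C \<inter> \<Union>\<W>' = {})"
  proof (cases "F = {}")
    case True
    then have "topspace T \<subseteq> \<Union>\<W>" by (simp add: F_def)
    then obtain \<W>' where \<W>': "finite \<W>'" "\<W>' \<subseteq> \<W>" "topspace T \<subseteq> \<Union>\<W>'"
      using T \<W>op unfolding compact_space_alt by meson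
    have "\<not> C \<inter> \<Union>\<W>' = {}" if "C \<in> closed_chains T UNIV" for C
      using closed_chains_subset[OF that] \<W>'(3) that by (auto simp: closed_chains_UNIV)
    then show ?thesis using \<W>' by (intro exI[of _ "{}"] exI[of _ \<W>']) auto
  next
    case False
    have "openin T (\<Union>\<W>)" using \<W>op by blast
    then have "F \<in> closed_chains T UNIV" using False by (simp add: F_def closed_chains_UNIV closedin_diff)
    then have "F \<in> \<Union>\<C>" using \<C>sub by simp
    then obtain B where B: "B \<in> \<C>" "F \<in> B" by (rule UnionE)
    moreover have "B \<in> ?B" using B(1) \<C>(1) by (rule rev_subsetD)
    then obtain V where V: "clopenin T V" "B = ?box V \<or> B = ?dia V" by auto
    ultimately have "B = ?box V" "F \<subseteq> V"
      by (auto simp: \<W>_def F_def cc_box_def cc_diamond_def)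
    then have "topspace T \<subseteq> \<Union>(insert V \<W>)" by (auto simp: F_def)
    moreover have "\<forall>W\<in>insert V \<W>. openin T W" using \<W>op V(1) by (simp add: clopenin_def)
    ultimately obtain \<U> where \<U>: "finite \<U>" "\<U> \<subseteq> insert V \<W>" "topspace T \<subseteq> \<Union>\<U>"
      using T unfolding compact_space_alt by meson
    \<comment> \<open>A closed set outside the box of \<open>V\<close> has a point outside
      \<open>V\<close>, so it meets a member of \<open>?W\<close> and lies in the corresponding
      diamond.\<close>
    let ?W = "\<U> - {V}"
    have "C \<in> \<Union>{B} \<or> \<not> C \<inter> \<Union>?W = {}" if C: "C \<in> closed_chains T UNIV" for C
    proof (cases "C \<subseteq> V")
      case True
      then show ?thesis using C \<open>B = ?box V\<close> by (simp add: cc_box_def)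
    next
      case False
      then show ?thesis using closed_chains_subset[OF C] \<U>(3) by auto
    qed
    then show ?thesis using \<U>(1,2) B(1) by (intro exI[of _ "{B}"] exI[of _ ?W]) auto
  qed
  then obtain \<D> \<W>' where D: "finite \<D>" "\<D> \<subseteq> \<C>" "finite \<W>'" "\<W>' \<subseteq> \<W>"
    and cov: "\<And>C. C \<in> closed_chains T UNIV \<Longrightarrow> C \<in> \<Union>\<D> \<or> \<not> C \<inter> \<Union>\<W>' = {}"
    by auto
  show "\<exists>\<C>'. finite \<C>' \<and> \<C>' \<subseteq> \<C> \<and> \<Union>\<C>' = \<Union>?B"
  proof (intro exI conjI)
    show "finite (\<D> \<union> ?dia ` \<W>')" using D by simp
    show *: "\<D> \<union> ?dia ` \<W>' \<subseteq> \<C>" using D by (auto simp: \<W>_def)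
    show "\<Union>(\<D> \<union> ?dia ` \<W>') = \<Union>?B"
      unfolding UB
    proof
      show "\<Union>(\<D> \<union> ?dia ` \<W>') \<subseteq> closed_chains T UNIV"
        using Union_mono[OF *] \<C>sub by simp
      show "closed_chains T UNIV \<subseteq> \<Union>(\<D> \<union> ?dia ` \<W>')"
      proof
        fix C assume C: "C \<in> closed_chains T UNIV"
        show "C \<in> \<Union>(\<D> \<union> ?dia ` \<W>')" using cov[OF C] C by (auto simp: cc_diamond_def)
      qed
    qed
  qed
qed

text \<open>Boxes of two sets intersect in the box of their intersection, so one box and finitely
  many diamonds suffice. The predicate \<open>Q\<close> carries this normal form through the
  inductive generation of the topology.\<close>

lemma cc_basis:
  assumes "openin (cc_topology T r) W" "C \<in> W"
  obtains V \<W> where "clopenin T V" "finite \<W>" "\<And>U. U \<in> \<W> \<Longrightarrow> clopenin T U"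
    "C \<subseteq> V" "\<And>U. U \<in> \<W> \<Longrightarrow> C \<inter> U \<noteq> {}"
    "\<And>D. D \<in> closed_chains T r \<Longrightarrow> D \<subseteq> V \<Longrightarrow> (\<And>U. U \<in> \<W> \<Longrightarrow> D \<inter> U \<noteq> {}) \<Longrightarrow> D \<in> W"
proof -
  define Q where "Q W V \<W> \<longleftrightarrow> clopenin T V \<and> finite \<W> \<and> (\<forall>U\<in>\<W>. clopenin T U) \<and> C \<subseteq> V \<and> (\<forall>U\<in>\<W>. C \<inter> U \<noteq> {})
    \<and> (\<forall>D\<in>closed_chains T r. D \<subseteq> V \<longrightarrow> (\<forall>U\<in>\<W>. D \<inter> U \<noteq> {}) \<longrightarrow> D \<in> W)" for W V \<W>
  have "generate_topology_on (cc_box T r ` {V. clopenin T V} \<union> cc_diamond T r ` {V. clopenin T V}) W"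
    using assms(1) unfolding cc_topology_def by (rule openin_topology_generated_by)
  then have "C \<in> W \<longrightarrow> (\<exists>V \<W>. Q W V \<W>)"
  proof induction
    case Empty
    then show ?case by simp
  next
    case (Int a b)
    show ?case
    proof
      assume "C \<in> a \<inter> b"
      then obtain V1 W1 V2 W2 where Q: "Q a V1 W1" "Q b V2 W2" using Int.IH by blast
      have "Q (a \<inter> b) (V1 \<inter> V2) (W1 \<union> W2)"
        using Q unfolding Q_def by (simp add: clopenin_Int ball_Un)
      then show "\<exists>V \<W>. Q (a \<inter> b) V \<W>" by blast
    qed
  next
    case (UN K)
    show ?case
    proof
      assume "C \<in> \<Union>K"
      then obtain k where k: "k \<in> K" "C \<in> k" by (rule UnionE)
      then obtain V \<W> where "Q k V \<W>" using UN.IH[OF k(1)] by blast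
      then have "Q (\<Union>K) V \<W>" using k(1) unfolding Q_def by auto
      then show "\<exists>V \<W>. Q (\<Union>K) V \<W>" by blast
    qed
  next
    case (Basis s)
    show ?case
    proof
      assume C: "C \<in> s"
      have "C \<in> closed_chains T r" using C Basis by (auto simp: cc_box_def cc_diamond_def)
      then have CT: "C \<subseteq> topspace T" by (rule closed_chains_subset)
      obtain V where V: "clopenin T V" and s: "s = cc_box T r V \<or> s = cc_diamond T r V" using Basis by auto
      show "\<exists>V \<W>. Q s V \<W>" using s
      proof
        assume s: "s = cc_box T r V"
        then show ?thesis using V C unfolding Q_def
          by (intro exI[of _ V] exI[of _ "{}"]) (auto simp: cc_box_def)
      next
        assume s: "s = cc_diamond T r V"
        then show ?thesis using V C CT clopenin_topspace[of T] unfolding Q_def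
          by (intro exI[of _ "topspace T"] exI[of _ "{V}"]) (auto simp: cc_diamond_def)
      qed
    qed
  qed
  then obtain V \<W> where "Q W V \<W>" using assms(2) by blast
  then show thesis using that[of V \<W>] unfolding Q_def by blast
qed

section \<open>Compactness of the space of closed chains\<close>

context priestley
begin

lemma chain_cmp: "C \<in> closed_chains T r \<Longrightarrow> x \<in> C \<Longrightarrow> y \<in> C \<Longrightarrow> (x, y) \<in> r \<or> (y, x) \<in> r"
  by (auto simp: closed_chains_def Chains_def)

text \<open>Incomparable points \<open>x\<close>, \<open>y\<close> have clopen upsets
  \<open>U\<close>, \<open>V\<close>, each containing exactly one of them. Meeting both
  \<open>U - V\<close> and \<open>V - U\<close> is an open condition that no chain
  satisfies.\<close>

lemma closedin_closed_chains: "closedin (cc_topology T UNIV) (closed_chains T r)"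
proof -
  let ?V = "cc_topology T UNIV"
  have "openin ?V (topspace ?V - closed_chains T r)"
  proof (subst openin_subopen, rule ballI)
    fix C assume C: "C \<in> topspace ?V - closed_chains T r"
    then have CV: "C \<noteq> {}" "closedin T C" "C \<in> closed_chains T UNIV" by (auto simp: closed_chains_UNIV)
    then obtain x y where xy: "x \<in> C" "y \<in> C" "(x, y) \<notin> r" "(y, x) \<notin> r"
      using C by (auto simp: closed_chains_def Chains_def)
    then have "x \<in> topspace T" "y \<in> topspace T" using closedin_subset[OF CV(2)] by auto
    then obtain U V where UV: "U \<in> clopen_upsets" "x \<in> U" "y \<notin> U" "V \<in> clopen_upsets" "y \<in> V" "x \<notin> V"
      using clopen_upsets_separates xy(3,4) by metis
    let ?N = "cc_diamond T UNIV (U - V) \<inter> cc_diamond T UNIV (V - U)"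
    have "openin ?V ?N" using UV by (intro openin_Int openin_cc_diamond clopenin_Diff clopen_upsets_clopen)
    moreover have "C \<in> ?N" using CV(3) UV xy by (auto simp: cc_diamond_def)
    moreover have "?N \<inter> closed_chains T r = {}"
    proof (rule equals0I)
      fix D assume D: "D \<in> ?N \<inter> closed_chains T r"
      then obtain u v where "u \<in> D" "v \<in> D" "u \<in> U - V" "v \<in> V - U" by (auto simp: cc_diamond_def)
      then show False
        using chain_cmp[of D u v] D clopen_upsets_up[OF UV(1), of u v] clopen_upsets_up[OF UV(4), of v u] by auto
    qed
    moreover have "?N \<subseteq> topspace ?V" by (auto simp: cc_diamond_def)
    ultimately have "openin ?V ?N \<and> C \<in> ?N \<and> ?N \<subseteq> topspace ?V - closed_chains T r" by auto
    then show "\<exists>W. openin ?V W \<and> C \<in> W \<and> W \<subseteq> topspace ?V - closed_chains T r" by (rule exI)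
  qed
  moreover have "closed_chains T r \<subseteq> closed_chains T UNIV" by (auto simp: closed_chains_def Chains_def)
  ultimately show ?thesis by (simp add: closedin_def)
qed

text \<open>The chains are closed in the compact hyperspace. Since \<open>cc_topology T r\<close> is
  generated by its own subbasis, compactness is carried over by the identity map, whose continuity
  is checked on subbasic sets.\<close>

lemma compact_space_cc: "compact_space (cc_topology T r)"
proof -
  let ?V = "cc_topology T UNIV"
  have sub: "closed_chains T r \<subseteq> closed_chains T UNIV" by (auto simp: closed_chains_def Chains_def)
  have "compactin ?V (closed_chains T r)"
    using closedin_closed_chains compact_space_vietoris[OF compact] by (rule closedin_compact_space[rotated])
  then have "compactin (subtopology ?V (closed_chains T r)) (closed_chains T r)"
    by (simp add: compactin_subtopology)
  moreover have "continuous_map (subtopology ?V (closed_chains T r)) (cc_topology T r) (\<lambda>C. C)"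
    unfolding cc_topology_def[of T r]
  proof (rule continuous_on_generated_topo)
    fix U assume "U \<in> cc_box T r ` {V. clopenin T V} \<union> cc_diamond T r ` {V. clopenin T V}"
    then obtain V where V: "clopenin T V" "U = cc_box T r V \<or> U = cc_diamond T r V" by auto
    obtain W where W: "openin ?V W" "U = W \<inter> closed_chains T r"
      using V(2)
    proof
      assume "U = cc_box T r V"
      then have "U = cc_box T UNIV V \<inter> closed_chains T r" using sub by (auto simp: cc_box_def)
      then show thesis using that openin_cc_box[OF V(1)] by blast
    next
      assume "U = cc_diamond T r V"
      then have "U = cc_diamond T UNIV V \<inter> closed_chains T r" using sub by (auto simp: cc_diamond_def)
      then show thesis using that openin_cc_diamond[OF V(1)] by blast
    qed
    have "(\<lambda>C. C) -` U \<inter> topspace (subtopology ?V (closed_chains T r)) = W \<inter> closed_chains T r"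
      using W(2) sub by auto
    then show "openin (subtopology ?V (closed_chains T r))
        ((\<lambda>C. C) -` U \<inter> topspace (subtopology ?V (closed_chains T r)))"
      using W(1) by (simp only: openin_subtopology_Int)
  next
    show "(\<lambda>C. C) ` topspace (subtopology ?V (closed_chains T r))
      \<subseteq> \<Union>(cc_box T r ` {V. clopenin T V} \<union> cc_diamond T r ` {V. clopenin T V})"
      unfolding cc_subbasis_Union by simp
  qed
  ultimately have "compactin (cc_topology T r) ((\<lambda>C. C) ` closed_chains T r)"
    by (rule image_compactin)
  then show ?thesis by (simp add: compact_space_def)
qed

end

section \<open>The order on closed chains\<close>

lemma cc_orderD:
  assumes "(C, D) \<in> cc_order T r"
  shows "C \<in> closed_chains T r" "D \<in> closed_chains T r" "D \<subseteq> C"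
    and "\<And>x y. x \<in> D \<Longrightarrow> y \<in> C \<Longrightarrow> (x, y) \<in> r \<Longrightarrow> y \<in> D"
  using assms by (auto simp: cc_order_def upset_of_def)

lemma cc_orderI:
  assumes "C \<in> closed_chains T r" "D \<in> closed_chains T r" "D \<subseteq> C"
    and "\<And>x y. x \<in> D \<Longrightarrow> y \<in> C \<Longrightarrow> (x, y) \<in> r \<Longrightarrow> y \<in> D"
  shows "(C, D) \<in> cc_order T r"
  using assms by (simp add: cc_order_def upset_of_def)

lemma closed_chains_closed_subset:
  assumes "C \<in> closed_chains T r" "closedin T F" "C \<inter> F \<noteq> {}"
  shows "C \<inter> F \<in> closed_chains T r"
  using assms by (auto simp: closed_chains_def Chains_def)

lemma partial_order_on_cc: "partial_order_on (closed_chains T r) (cc_order T r)"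
proof -
  have "trans (cc_order T r)"
  proof (rule transI)
    fix C D E assume CD: "(C, D) \<in> cc_order T r" and DE: "(D, E) \<in> cc_order T r"
    show "(C, E) \<in> cc_order T r"
    proof (rule cc_orderI)
      show "C \<in> closed_chains T r" "E \<in> closed_chains T r" "E \<subseteq> C"
        using cc_orderD(1-3)[OF CD] cc_orderD(1-3)[OF DE] by auto
      fix x y assume "x \<in> E" "y \<in> C" "(x, y) \<in> r"
      then show "y \<in> E" using cc_orderD(3,4)[OF DE] cc_orderD(4)[OF CD, of x y] by auto
    qed
  qed
  moreover have "antisym (cc_order T r)" by (rule antisymI) (auto dest: cc_orderD(3))
  moreover have "refl_on (closed_chains T r) (cc_order T r)" by (rule refl_onI) (auto intro: cc_orderI)
  ultimately show ?thesis
    by (auto simp: partial_order_on_def preorder_on_def dest: cc_orderD(1,2))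
qed

lemma clopenin_finite_Int_INT:
  assumes "finite I" "clopenin T N" "\<And>i. i \<in> I \<Longrightarrow> clopenin T (f i)"
  shows "clopenin T (N \<inter> \<Inter>(f ` I))"
  using assms(1,3)
proof (induction I)
  case empty
  then show ?case using assms(2) by simp
next
  case (insert i I)
  have "N \<inter> \<Inter>(f ` insert i I) = f i \<inter> (N \<inter> \<Inter>(f ` I))" by auto
  then show ?case using insert by (simp add: clopenin_Int)
qed

context priestley
begin

text \<open>Two upsets of one chain are comparable by inclusion, and the smaller one is then an
  upset of the larger one.\<close>

lemma root_system_cc: "root_system (closed_chains T r) (cc_order T r)"
  unfolding root_system_def
proof (intro conjI ballI partial_order_on_cc)
  fix C assume C: "C \<in> closed_chains T r"
  have "(D, E) \<in> cc_order T r \<or> (E, D) \<in> cc_order T r"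
    if CD: "(C, D) \<in> cc_order T r" and CE: "(C, E) \<in> cc_order T r" for D E
  proof (cases "D \<subseteq> E")
    case True
    have "(E, D) \<in> cc_order T r"
      using cc_orderD(2)[OF CD] cc_orderD(2)[OF CE] True cc_orderD(4)[OF CD] cc_orderD(3)[OF CE]
      by (intro cc_orderI) auto
    then show ?thesis by blast
  next
    case False
    then obtain d where d: "d \<in> D" "d \<notin> E" by blast
    have "E \<subseteq> D"
    proof
      fix x assume x: "x \<in> E"
      have "(d, x) \<in> r \<or> (x, d) \<in> r"
        using chain_cmp[OF C, of d x] x d cc_orderD(3)[OF CD] cc_orderD(3)[OF CE] by auto
      then show "x \<in> D"
        using cc_orderD(4)[OF CE x, of d] cc_orderD(4)[OF CD d(1), of x] d x
          cc_orderD(3)[OF CD] cc_orderD(3)[OF CE] by auto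
    qed
    then have "(D, E) \<in> cc_order T r"
      using cc_orderD(2)[OF CD] cc_orderD(2)[OF CE] cc_orderD(4)[OF CE] cc_orderD(3)[OF CD]
      by (intro cc_orderI) auto
    then show ?thesis by blast
  qed
  then show "cc_order T r `` {C} \<in> Chains (cc_order T r)" by (auto simp: Chains_def)
qed

definition cc_clopen_upsets :: "'a set set set" where
  "cc_clopen_upsets = {\<U>. clopenin (cc_topology T r) \<U> \<and> upset_of (closed_chains T r) (cc_order T r) \<U>}"

lemma cc_box_clopen_upsets: "clopenin T V \<Longrightarrow> cc_box T r V \<in> cc_clopen_upsets"
  using clopenin_cc_box[of T V r] by (auto simp: cc_clopen_upsets_def upset_of_def cc_box_def dest: cc_orderD(3))

text \<open>In the algebra of clopen upsets this set is \<open>(\<box>U \<rightarrow> \<box>V) \<rightarrow> \<box>U\<close>, which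
  is why it belongs to the subalgebra generated by the sets \<open>\<box>U\<close>.\<close>

lemma cc_box_diamond_clopen_upsets:
  assumes U: "U \<in> clopen_upsets" and V: "V \<in> clopen_upsets"
  shows "cc_box T r U \<union> cc_diamond T r (U - V) \<in> cc_clopen_upsets"
proof -
  have "clopenin (cc_topology T r) (cc_box T r U \<union> cc_diamond T r (U - V))"
    using U V by (intro clopenin_Un clopenin_cc_box clopenin_cc_diamond clopenin_Diff clopen_upsets_clopen)
  moreover have "D \<in> cc_box T r U \<union> cc_diamond T r (U - V)"
    if CD: "(C, D) \<in> cc_order T r" and C: "C \<in> cc_box T r U \<union> cc_diamond T r (U - V)" for C D
  proof (cases "D \<subseteq> U")
    case True
    then show ?thesis using cc_orderD(2)[OF CD] by (simp add: cc_box_def)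
  next
    case False
    then obtain d where d: "d \<in> D" "d \<notin> U" by blast
    then have "C \<in> cc_diamond T r (U - V)"
      using C cc_orderD(3)[OF CD] by (auto simp: cc_box_def)
    then obtain c where c: "c \<in> C" "c \<in> U - V" by (auto simp: cc_diamond_def)
    have "(d, c) \<in> r \<or> (c, d) \<in> r" 
      using chain_cmp[OF cc_orderD(1)[OF CD], of d c] c d cc_orderD(3)[OF CD] by auto
    then have "(d, c) \<in> r" using clopen_upsets_up[OF U, of c d] c d by auto
    then have "c \<in> D" using cc_orderD(4)[OF CD d(1) c(1)] by auto
    then show ?thesis using c cc_orderD(2)[OF CD] by (auto simp: cc_diamond_def)
  qed
  moreover have "cc_box T r U \<union> cc_diamond T r (U - V) \<subseteq> closed_chains T r"
    by (auto simp: cc_box_def cc_diamond_def)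
  ultimately show ?thesis unfolding cc_clopen_upsets_def upset_of_def by blast
qed

text \<open>The separating sets are named explicitly, not just as clopen upsets, so that the
  generation argument can recognise them as implications.\<close>

lemma cc_separation:
  assumes C: "C \<in> closed_chains T r" and D: "D \<in> closed_chains T r" and CD: "(C, D) \<notin> cc_order T r"
  obtains U V where "U \<in> clopen_upsets" "V \<in> clopen_upsets" "C \<in> cc_box T r (topspace T - (U - V))"
      "D \<notin> cc_box T r (topspace T - (U - V))"
  | U V where "U \<in> clopen_upsets" "V \<in> clopen_upsets" "C \<in> cc_box T r U \<union> cc_diamond T r (U - V)"
      "D \<notin> cc_box T r U \<union> cc_diamond T r (U - V)"
proof (cases "D \<subseteq> C")
  case False
  then obtain d where d: "d \<in> D" "d \<notin> C" by blast
  moreover have "closedin T C" using C by (simp add: closed_chains_def)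
  ultimately obtain U V where UV: "U \<in> clopen_upsets" "V \<in> clopen_upsets" "d \<in> U - V" "(U - V) \<inter> C = {}"
    using point_separation[of C d] closed_chains_subset[OF D] by blast
  show thesis
  proof (rule that(1)[OF UV(1,2)])
    show "C \<in> cc_box T r (topspace T - (U - V))"
      using C UV(4) closed_chains_subset[OF C] by (auto simp: cc_box_def)
    show "D \<notin> cc_box T r (topspace T - (U - V))"
      using d UV(3) by (auto simp: cc_box_def)
  qed
next
  case True
  then obtain d c where dc: "d \<in> D" "c \<in> C" "(d, c) \<in> r" "c \<notin> D"
    using CD C D by (auto simp: cc_order_def upset_of_def)
  moreover have "closedin T D" using D by (simp add: closed_chains_def)
  ultimately obtain U V where UV: "U \<in> clopen_upsets" "V \<in> clopen_upsets" "c \<in> U - V" "(U - V) \<inter> D = {}"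
    using point_separation[of D c] closed_chains_subset[OF C] by blast
  \<comment> \<open>\<open>c\<close> lies outside the upset \<open>V\<close> and above
    \<open>d\<close>, so \<open>d\<close> is outside \<open>V\<close>. As \<open>U - V\<close>
    misses \<open>D\<close>, \<open>d\<close> is outside \<open>U\<close> as well and keeps
    \<open>D\<close> out of the box of \<open>U\<close>.\<close>
  have "d \<notin> V" using clopen_upsets_up[OF UV(2) _ dc(3)] UV(3) by auto
  then have "d \<notin> U" using UV(4) dc(1) by auto
  show thesis
  proof (rule that(2)[OF UV(1,2)])
    show "C \<in> cc_box T r U \<union> cc_diamond T r (U - V)"
      using C UV(3) dc(2) by (auto simp: cc_diamond_def)
    show "D \<notin> cc_box T r U \<union> cc_diamond T r (U - V)"
      using UV(4) dc(1) \<open>d \<notin> U\<close> by (auto simp: cc_diamond_def cc_box_def)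
  qed
qed

lemma priestley_space_cc: "priestley_space (cc_topology T r) (cc_order T r)"
  unfolding priestley_space_def topspace_cc
proof (intro conjI ballI impI compact_space_cc partial_order_on_cc)
  fix C D assume C: "C \<in> closed_chains T r" and D: "D \<in> closed_chains T r" and CD: "(C, D) \<notin> cc_order T r"
  obtain \<U> where "\<U> \<in> cc_clopen_upsets" "C \<in> \<U>" "D \<notin> \<U>"
  proof (rule cc_separation[OF C D CD])
    fix U V assume "U \<in> clopen_upsets" "V \<in> clopen_upsets" and CD: "C \<in> cc_box T r (topspace T - (U - V))"
      "D \<notin> cc_box T r (topspace T - (U - V))"
    then have "cc_box T r (topspace T - (U - V)) \<in> cc_clopen_upsets"
      by (intro cc_box_clopen_upsets clopenin_Diff clopenin_topspace clopen_upsets_clopen)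
    then show thesis using CD that by blast
  next
    fix U V assume "U \<in> clopen_upsets" "V \<in> clopen_upsets" and CD: "C \<in> cc_box T r U \<union> cc_diamond T r (U - V)"
      "D \<notin> cc_box T r U \<union> cc_diamond T r (U - V)"
    then show thesis using that[OF cc_box_diamond_clopen_upsets] by blast
  qed
  then show "\<exists>U. clopenin (cc_topology T r) U \<and> upset_of (closed_chains T r) (cc_order T r) U \<and> C \<in> U \<and> D \<notin> U"
    by (auto simp: cc_clopen_upsets_def)
qed

text \<open>For \<open>D\<close> in \<open>W\<close> above \<open>C\<close>, a clopen upset
  \<open>S\<close> around \<open>D\<close> cuts \<open>C\<close> down to a part inside the basic
  neighbourhood of \<open>D\<close>. The same \<open>S\<close> cuts every chain \<open>E\<close>
  near \<open>C\<close> to a member \<open>E \<inter> S\<close> of \<open>W\<close> above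
  \<open>E\<close>.\<close>

lemma openin_cc_downset:
  assumes W: "openin (cc_topology T r) W"
  shows "openin (cc_topology T r) ((cc_order T r)\<inverse> `` W)"
proof (subst openin_subopen, rule ballI)
  fix C assume "C \<in> (cc_order T r)\<inverse> `` W"
  then obtain D where CD: "(C, D) \<in> cc_order T r" and DW: "D \<in> W" by auto
  obtain V \<W> where V: "clopenin T V" and \<W>: "finite \<W>" "\<And>U. U \<in> \<W> \<Longrightarrow> clopenin T U"
    and DV: "D \<subseteq> V" "\<And>U. U \<in> \<W> \<Longrightarrow> D \<inter> U \<noteq> {}"
    and basic: "\<And>E. E \<in> closed_chains T r \<Longrightarrow> E \<subseteq> V \<Longrightarrow> (\<And>U. U \<in> \<W> \<Longrightarrow> E \<inter> U \<noteq> {}) \<Longrightarrow> E \<in> W"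
    by (rule cc_basis[OF W DW]) blast
  have C: "closedin T C" and D: "closedin T D" "D \<noteq> {}"
    using cc_orderD(1,2)[OF CD] by (simp_all add: closed_chains_def)
  obtain S where S: "S \<in> clopen_upsets" "D \<subseteq> S" "S \<inter> (C - V) = {}"
  proof (rule closed_separation[of D "C - V"])
    show "closedin T (C - V)" using C V by (simp add: closedin_diff clopenin_def)
    fix x y assume "x \<in> D" "y \<in> C - V"
    then show "(x, y) \<notin> r" using cc_orderD(4)[OF CD, of x y] DV(1) by auto
  qed (use D in auto)
  have Sc: "clopenin T S" by (rule clopen_upsets_clopen[OF S(1)])
  \<comment> \<open>The three conditions say that \<open>E \<inter> S\<close> is inside
    \<open>V\<close>, nonempty, and meets each \<open>U\<close> in \<open>\<W>\<close>. The diamond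
    of \<open>S\<close> matters when \<open>\<W>\<close> is empty.\<close>
  let ?N = "(cc_box T r ((topspace T - S) \<union> V) \<inter> cc_diamond T r S) \<inter> \<Inter>((\<lambda>U. cc_diamond T r (S \<inter> U)) ` \<W>)"
  have "clopenin (cc_topology T r) ?N"
    using \<W> V Sc by (intro clopenin_finite_Int_INT clopenin_intros clopenin_cc_box clopenin_cc_diamond)
  moreover have "C \<in> ?N"
  proof -
    have "C \<subseteq> (topspace T - S) \<union> V" using closedin_subset[OF C] S(3) by auto
    moreover have "C \<inter> S \<noteq> {}" using D(2) S(2) cc_orderD(3)[OF CD] by auto
    moreover have "C \<inter> (S \<inter> U) \<noteq> {}" if "U \<in> \<W>" for U
      using DV(2)[OF that] S(2) cc_orderD(3)[OF CD] by auto
    ultimately show ?thesis using cc_orderD(1)[OF CD] by (auto simp: cc_box_def cc_diamond_def)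
  qed
  moreover have "?N \<subseteq> (cc_order T r)\<inverse> `` W"
  proof
    fix E assume E: "E \<in> ?N"
    then have EK: "E \<in> closed_chains T r" and ES: "E \<inter> S \<noteq> {}" and EV: "E \<subseteq> (topspace T - S) \<union> V"
      by (auto simp: cc_box_def cc_diamond_def)
    have ES': "E \<inter> S \<in> closed_chains T r"
      using closed_chains_closed_subset[OF EK _ ES] Sc by (simp add: clopenin_def)
    have "(E, E \<inter> S) \<in> cc_order T r" using EK ES' clopen_upsets_up[OF S(1)] by (intro cc_orderI) auto
    moreover have "E \<inter> S \<in> W"
    proof (rule basic[OF ES'])
      show "E \<inter> S \<subseteq> V" using EV by auto
      fix U assume "U \<in> \<W>"
      then have "E \<in> cc_diamond T r (S \<inter> U)" using E by auto
      then show "E \<inter> S \<inter> U \<noteq> {}" by (auto simp: cc_diamond_def)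
    qed
    ultimately show "E \<in> (cc_order T r)\<inverse> `` W" by auto
  qed
  ultimately have "openin (cc_topology T r) ?N \<and> C \<in> ?N \<and> ?N \<subseteq> (cc_order T r)\<inverse> `` W"
    by (simp add: clopenin_def)
  then show "\<exists>N. openin (cc_topology T r) N \<and> C \<in> N \<and> N \<subseteq> (cc_order T r)\<inverse> `` W" by (rule exI)
qed

lemma esakia_space_cc: "esakia_space (cc_topology T r) (cc_order T r)"
proof -
  interpret cc: priestley "cc_topology T r" "cc_order T r"
    by unfold_locales (rule priestley_space_cc)
  show ?thesis
    using priestley_space_cc cc.closedin_downset openin_cc_downset
    by (simp add: esakia_space_def clopenin_def)
qed

end

section \<open>The algebra of clopen upsets\<close>

locale esakia = priestley +
  assumes esakia: "esakia_space T r"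
begin

abbreviation "A \<equiv> clopen_upset_algebra T r"

lemma carrier_A [simp]: "carrier A = clopen_upsets"
  by (simp add: clopen_upset_algebra_def clopen_upsets_def)

lemma le_A [simp]: "U \<sqsubseteq>\<^bsub>A\<^esub> V \<longleftrightarrow> U \<subseteq> V"
  by (simp add: clopen_upset_algebra_def)

lemma eq_A [simp]: "U .=\<^bsub>A\<^esub> V \<longleftrightarrow> U = V"
  by (simp add: clopen_upset_algebra_def)

lemma himp_A [simp]: "U \<rightharpoonup>\<^bsub>A\<^esub> V = topspace T - r\<inverse> `` (U - V)"
  by (simp add: clopen_upset_algebra_def)

lemma himp_clopen_upsets:
  assumes "U \<in> clopen_upsets" "V \<in> clopen_upsets"
  shows "topspace T - r\<inverse> `` (U - V) \<in> clopen_upsets"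
proof -
  have "clopenin T (topspace T - r\<inverse> `` (U - V))"
    using assms esakia by (intro clopenin_Diff clopenin_topspace) (simp add: esakia_space_def clopenin_Diff clopen_upsets_clopen)
  moreover have "upset_of (topspace T) r (topspace T - r\<inverse> `` (U - V))"
    unfolding upset_of_def using r_trans by blast
  ultimately show ?thesis by (simp add: clopen_upsets_def)
qed

lemma himp_residual_A:
  assumes U: "U \<in> clopen_upsets" and "V \<in> clopen_upsets" and W: "W \<in> clopen_upsets"
  shows "W \<subseteq> topspace T - r\<inverse> `` (U - V) \<longleftrightarrow> W \<inter> U \<subseteq> V"
proof
  assume L: "W \<subseteq> topspace T - r\<inverse> `` (U - V)"
  show "W \<inter> U \<subseteq> V"
  proof (rule subsetI, rule ccontr)
    fix w assume w: "w \<in> W \<inter> U" "w \<notin> V"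
    then have "w \<in> topspace T" using clopenin_subset[OF clopen_upsets_clopen[OF W]] by auto
    then have "w \<in> r\<inverse> `` (U - V)" using w r_refl[of w] by auto
    then show False using L w by auto
  qed
next
  assume R: "W \<inter> U \<subseteq> V"
  show "W \<subseteq> topspace T - r\<inverse> `` (U - V)"
  proof
    fix w assume w: "w \<in> W"
    then have "w \<in> topspace T" using clopenin_subset[OF clopen_upsets_clopen[OF W]] by auto
    moreover have "w \<notin> r\<inverse> `` (U - V)" using clopen_upsets_up[OF W w] R by auto
    ultimately show "w \<in> topspace T - r\<inverse> `` (U - V)" by simp
  qed
qed

lemma least_A: "U \<in> clopen_upsets \<Longrightarrow> V \<in> clopen_upsets \<Longrightarrow> least A (U \<union> V) (Upper A {U, V})"
  by (rule least_UpperI) (auto simp: Upper_def clopen_upsets_Un)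

lemma greatest_A: "U \<in> clopen_upsets \<Longrightarrow> V \<in> clopen_upsets \<Longrightarrow> greatest A (U \<inter> V) (Lower A {U, V})"
  by (rule greatest_LowerI) (auto simp: Lower_def clopen_upsets_Int)

lemma bounded_lattice_A: "bounded_lattice A"
proof -
  have "greatest A (topspace T) clopen_upsets"
    using clopenin_subset[OF clopen_upsets_clopen] by (auto simp: greatest_def clopen_upsets_topspace)
  moreover have "least A {} clopen_upsets" by (auto simp: least_def clopen_upsets_empty)
  ultimately show ?thesis
    by unfold_locales (auto simp: fun_eq_iff intro: least_A greatest_A)
qed

interpretation A: bounded_lattice A by (rule bounded_lattice_A)

text \<open>\<open>join\<close> is a chosen least upper bound of the pair; uniqueness identifies it
  with the union.\<close>

lemma join_A: "U \<in> clopen_upsets \<Longrightarrow> V \<in> clopen_upsets \<Longrightarrow> U \<squnion>\<^bsub>A\<^esub> V = U \<union> V"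
  using A.least_unique[OF A.sup_of_two_least least_A, of U V] by (simp add: join_def)

lemma meet_A: "U \<in> clopen_upsets \<Longrightarrow> V \<in> clopen_upsets \<Longrightarrow> U \<sqinter>\<^bsub>A\<^esub> V = U \<inter> V"
  using A.greatest_unique[OF A.inf_of_two_greatest greatest_A, of U V] by (simp add: meet_def)

lemma top_A: "\<top>\<^bsub>A\<^esub> = topspace T"
  by (rule A.top_eq[symmetric]) (auto simp: clopen_upsets_topspace dest: clopen_upsets_clopen clopenin_subset)

lemma bottom_A: "\<bottom>\<^bsub>A\<^esub> = {}"
  by (rule A.bottom_eq[symmetric]) (auto simp: clopen_upsets_empty)

lemma heyting_algebra_A: "heyting_algebra A"
proof unfold_locales
  fix U V W assume "U \<in> carrier A" "V \<in> carrier A" "W \<in> carrier A"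
  then show "W \<sqsubseteq>\<^bsub>A\<^esub> U \<rightharpoonup>\<^bsub>A\<^esub> V \<longleftrightarrow> W \<sqinter>\<^bsub>A\<^esub> U \<sqsubseteq>\<^bsub>A\<^esub> V"
    using himp_residual_A[of U V W] meet_A[of W U] by simp
qed (simp add: himp_clopen_upsets)

text \<open>A point below some \<open>u\<close> in \<open>U - V\<close> and some \<open>v\<close> in
  \<open>V - U\<close> would make \<open>u\<close> and \<open>v\<close> comparable, and then one of
  the two upsets would contain both.\<close>

lemma goedel_algebra_A:
  assumes root: "root_system (topspace T) r"
  shows "goedel_algebra A"
proof -
  interpret heyting_algebra A by (rule heyting_algebra_A)
  show ?thesis
  proof unfold_locales
    fix U V assume UV: "U \<in> carrier A" "V \<in> carrier A"
    have "x \<notin> r\<inverse> `` (U - V) \<or> x \<notin> r\<inverse> `` (V - U)" if x: "x \<in> topspace T" for x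
    proof (rule ccontr)
      assume "\<not> ?thesis"
      then obtain u v where uv: "(x, u) \<in> r" "u \<in> U - V" "(x, v) \<in> r" "v \<in> V - U" by auto
      then have "(u, v) \<in> r \<or> (v, u) \<in> r"
        using root x by (auto simp: root_system_def Chains_def)
      then show False using uv clopen_upsets_up[of U u v] clopen_upsets_up[of V v u] UV by auto
    qed
    then show "(U \<rightharpoonup>\<^bsub>A\<^esub> V) \<squnion>\<^bsub>A\<^esub> (V \<rightharpoonup>\<^bsub>A\<^esub> U) = \<top>\<^bsub>A\<^esub>"
      using UV himp_clopen_upsets by (auto simp: join_A top_A)
  qed
qed

end

section \<open>Implications between boxes, and generation by boxes\<close>

context priestley
begin

text \<open>If a chain has a point \<open>c\<close> in \<open>U - V\<close>, its part above
  \<open>c\<close> is a chain above it that stays inside the upset \<open>U\<close> but not inside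
  \<open>V\<close>.\<close>

lemma cc_himp_box:
  assumes U: "U \<in> clopen_upsets" and V: "V \<in> clopen_upsets"
  shows "closed_chains T r - (cc_order T r)\<inverse> `` (cc_box T r U - cc_box T r V)
    = cc_box T r (topspace T - (U - V))" (is "?L = ?R")
proof (intro equalityI subsetI)
  fix C assume C: "C \<in> ?L"
  have "c \<notin> U - V" if c: "c \<in> C" for c
  proof
    assume cUV: "c \<in> U - V"
    have cT: "c \<in> topspace T" using c C closed_chains_subset by blast
    let ?D = "C \<inter> r `` {c}"
    have "c \<in> ?D" using c r_refl[OF cT] by auto
    then have D: "?D \<in> closed_chains T r"
      using closed_chains_closed_subset[OF _ closedin_principal_upset] C by blast
    then have "(C, ?D) \<in> cc_order T r"
      using C r_trans by (intro cc_orderI) auto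
    moreover have "?D \<in> cc_box T r U - cc_box T r V"
      using D \<open>c \<in> ?D\<close> cUV clopen_upsets_up[OF U, of c] by (auto simp: cc_box_def)
    ultimately show False using C by auto
  qed
  then show "C \<in> ?R" using C closed_chains_subset by (fastforce simp: cc_box_def)
next
  fix C assume C: "C \<in> ?R"
  have "C \<notin> (cc_order T r)\<inverse> `` (cc_box T r U - cc_box T r V)"
  proof
    assume "C \<in> (cc_order T r)\<inverse> `` (cc_box T r U - cc_box T r V)"
    then obtain D where D: "(C, D) \<in> cc_order T r" "D \<in> cc_box T r U" "D \<notin> cc_box T r V" by auto
    then obtain x where "x \<in> D" "x \<in> U" "x \<notin> V" by (auto simp: cc_box_def)
    then show False using C cc_orderD(3)[OF D(1)] by (auto simp: cc_box_def)
  qed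
  then show "C \<in> ?L" using C by (simp add: cc_box_def)
qed

text \<open>A chain outside the right-hand side avoids \<open>U - V\<close> and is not inside
  \<open>U\<close>, so it refutes the implication itself. Conversely, the right-hand side is an
  upset, and none of its members avoids \<open>U - V\<close> without lying inside
  \<open>U\<close>.\<close>

lemma cc_himp_box_diamond:
  assumes U: "U \<in> clopen_upsets" and V: "V \<in> clopen_upsets"
  shows "closed_chains T r - (cc_order T r)\<inverse> `` (cc_box T r (topspace T - (U - V)) - cc_box T r U)
    = cc_box T r U \<union> cc_diamond T r (U - V)" (is "?L = ?R")
proof (intro equalityI subsetI)
  fix C assume C: "C \<in> ?L"
  show "C \<in> ?R"
  proof (rule ccontr)
    assume n: "C \<notin> ?R"
    have K: "C \<in> closed_chains T r" using C by simp
    then have "C \<subseteq> topspace T" by (rule closed_chains_subset)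
    then have "C \<in> cc_box T r (topspace T - (U - V)) - cc_box T r U"
      using n K by (auto simp: cc_box_def cc_diamond_def)
    moreover have "(C, C) \<in> cc_order T r" using K by (intro cc_orderI) auto
    ultimately show False using C by auto
  qed
next
  fix C assume C: "C \<in> ?R"
  have "C \<notin> (cc_order T r)\<inverse> `` (cc_box T r (topspace T - (U - V)) - cc_box T r U)"
  proof
    assume "C \<in> (cc_order T r)\<inverse> `` (cc_box T r (topspace T - (U - V)) - cc_box T r U)"
    then obtain D where D: "(C, D) \<in> cc_order T r" "D \<in> cc_box T r (topspace T - (U - V))" "D \<notin> cc_box T r U"
      by auto
    then have "D \<in> ?R"
      using upset_ofD[of _ "cc_order T r" ?R C D] C cc_box_diamond_clopen_upsets[OF U V] cc_orderD(2)[OF D(1)]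
      by (auto simp: cc_clopen_upsets_def)
    then show False using D(2,3) by (auto simp: cc_box_def cc_diamond_def)
  qed
  then show "C \<in> ?L" using C by (auto simp: cc_box_def cc_diamond_def)
qed

text \<open>Every clopen upset lies in the Heyting subalgebra generated by the \<open>\<box>U\<close>, since a sublattice
  of clopen upsets that separates the order contains all of them.\<close>

lemma cc_clopen_upsets_induct [consumes 1, case_names box Un Int imp]:
  assumes \<U>: "\<U> \<in> cc_clopen_upsets"
    and box: "\<And>U. U \<in> clopen_upsets \<Longrightarrow> P (cc_box T r U)"
    and Un: "\<And>\<U> \<V>. \<U> \<in> cc_clopen_upsets \<Longrightarrow> \<V> \<in> cc_clopen_upsets \<Longrightarrow> P \<U> \<Longrightarrow> P \<V> \<Longrightarrow> P (\<U> \<union> \<V>)"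
    and Int: "\<And>\<U> \<V>. \<U> \<in> cc_clopen_upsets \<Longrightarrow> \<V> \<in> cc_clopen_upsets \<Longrightarrow> P \<U> \<Longrightarrow> P \<V> \<Longrightarrow> P (\<U> \<inter> \<V>)"
    and imp: "\<And>\<U> \<V>. \<U> \<in> cc_clopen_upsets \<Longrightarrow> \<V> \<in> cc_clopen_upsets \<Longrightarrow> P \<U> \<Longrightarrow> P \<V> \<Longrightarrow>
      P (closed_chains T r - (cc_order T r)\<inverse> `` (\<U> - \<V>))"
  shows "P \<U>"
proof -
  interpret cc: priestley "cc_topology T r" "cc_order T r"
    by unfold_locales (rule priestley_space_cc)
  have clopen_upsets_eq: "cc.clopen_upsets = cc_clopen_upsets" by (simp add: cc.clopen_upsets_def cc_clopen_upsets_def)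
  let ?\<A> = "{\<V> \<in> cc_clopen_upsets. P \<V>}"
  have J: "cc_box T r (topspace T - (U - V)) \<in> ?\<A>" if UV: "U \<in> clopen_upsets" "V \<in> clopen_upsets" for U V
  proof -
    have "P (cc_box T r (topspace T - (U - V)))"
      unfolding cc_himp_box[OF UV, symmetric]
      using UV by (intro imp box cc_box_clopen_upsets clopen_upsets_clopen)
    moreover have "cc_box T r (topspace T - (U - V)) \<in> cc_clopen_upsets"
      using UV by (intro cc_box_clopen_upsets clopenin_Diff clopenin_topspace clopen_upsets_clopen)
    ultimately show ?thesis by simp
  qed
  have K: "cc_box T r U \<union> cc_diamond T r (U - V) \<in> ?\<A>" if UV: "U \<in> clopen_upsets" "V \<in> clopen_upsets" for U V
  proof -
    have "P (cc_box T r U \<union> cc_diamond T r (U - V))"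
      unfolding cc_himp_box_diamond[OF UV, symmetric]
      using imp[of "cc_box T r (topspace T - (U - V))" "cc_box T r U"] J[OF UV] box[OF UV(1)]
        cc_box_clopen_upsets[OF clopen_upsets_clopen[OF UV(1)]] by simp
    then show ?thesis using cc_box_diamond_clopen_upsets[OF UV] by simp
  qed
  have cl: "clopenin (cc_topology T r) \<U>" using \<U> by (simp add: cc_clopen_upsets_def)
  then have Ucl: "closedin (cc_topology T r) \<U>" "closedin (cc_topology T r) (closed_chains T r - \<U>)"
    using closedin_diff[of "cc_topology T r" "closed_chains T r" \<U>] closedin_topspace[of "cc_topology T r"]
    by (auto simp: clopenin_def)
  \<comment> \<open>Separating \<open>\<U>\<close> from its own complement leaves
    \<open>\<U>\<close> as the only candidate.\<close>
  obtain \<V> where \<V>: "\<V> \<in> ?\<A>" "\<U> \<subseteq> \<V>" "\<V> \<inter> (closed_chains T r - \<U>) = {}"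
  proof (rule compactin_separation[of "cc_topology T r" \<U> "closed_chains T r - \<U>" ?\<A>])
    show "compactin (cc_topology T r) \<U>" "compactin (cc_topology T r) (closed_chains T r - \<U>)"
      using Ucl compact_space_cc closedin_compact_space by auto
    show "clopenin (cc_topology T r) \<V>" if "\<V> \<in> ?\<A>" for \<V> using that by (simp add: cc_clopen_upsets_def)
    show "\<V> \<union> \<W> \<in> ?\<A>" if "\<V> \<in> ?\<A>" "\<W> \<in> ?\<A>" for \<V> \<W>
      using that Un cc.clopen_upsets_Un unfolding clopen_upsets_eq by simp
    show "\<V> \<inter> \<W> \<in> ?\<A>" if "\<V> \<in> ?\<A>" "\<W> \<in> ?\<A>" for \<V> \<W>
      using that Int cc.clopen_upsets_Int unfolding clopen_upsets_eq by simp
    \<comment> \<open>Chains are nonempty, so the box of the empty upset provides the bottom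
      element.\<close>
    have "cc_box T r {} = {}" by (auto simp: cc_box_def closed_chains_def)
    then show "{} \<in> ?\<A>" using box[OF clopen_upsets_empty] cc.clopen_upsets_empty unfolding clopen_upsets_eq by simp
    show "topspace (cc_topology T r) \<in> ?\<A>"
      using box[OF clopen_upsets_topspace] cc.clopen_upsets_topspace unfolding clopen_upsets_eq cc_box_topspace by simp
    fix C D assume C: "C \<in> \<U>" and D: "D \<in> closed_chains T r - \<U>"
    have CK: "C \<in> closed_chains T r" using C clopenin_subset[OF cl] by auto
    have CD: "(C, D) \<notin> cc_order T r" using C D \<U> by (auto simp: cc_clopen_upsets_def upset_of_def)
    show "\<exists>\<V>\<in>?\<A>. C \<in> \<V> \<and> D \<notin> \<V>"
    proof (rule cc_separation[OF CK DiffD1[OF D] CD])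
      fix U V assume UV: "U \<in> clopen_upsets" "V \<in> clopen_upsets" and CD: "C \<in> cc_box T r (topspace T - (U - V))"
        "D \<notin> cc_box T r (topspace T - (U - V))"
      show ?thesis by (rule bexI[OF _ J[OF UV]]) (intro conjI CD)
    next
      fix U V assume UV: "U \<in> clopen_upsets" "V \<in> clopen_upsets" and CD: "C \<in> cc_box T r U \<union> cc_diamond T r (U - V)"
        "D \<notin> cc_box T r U \<union> cc_diamond T r (U - V)"
      show ?thesis by (rule bexI[OF _ K[OF UV]]) (intro conjI CD)
    qed
  qed
  have "\<V> \<subseteq> closed_chains T r" using \<V>(1) clopenin_subset[of "cc_topology T r" \<V>] by (auto simp: cc_clopen_upsets_def)
  then have "\<V> = \<U>" using \<V>(2,3) by auto
  then show ?thesis using \<V>(1) by simp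
qed

end

section \<open>Duality for distributive lattices and Goedel algebras\<close>

text \<open>By residuation, meeting with \<open>x\<close> is a left adjoint and so preserves joins.
  The prime filter theory thereby applies to \<open>H\<close>.\<close>

sublocale heyting_algebra \<subseteq> bounded_distributive_lattice H
proof unfold_locales
  fix x y z assume c: "x \<in> carrier H" "y \<in> carrier H" "z \<in> carrier H"
  let ?w = "(x \<sqinter> y) \<squnion> (x \<sqinter> z)"
  have w: "?w \<in> carrier H" using c by simp
  have "y \<sqinter> x \<sqsubseteq> ?w" "z \<sqinter> x \<sqsubseteq> ?w"
    using c join_left[of "x \<sqinter> y" "x \<sqinter> z"] join_right[of "x \<sqinter> y" "x \<sqinter> z"]
      meet_comm[of H y x] meet_comm[of H z x] by simp_all
  then have "y \<squnion> z \<sqsubseteq> x \<rightharpoonup> ?w"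
    using c w by (intro join_le) (simp_all add: himp_residual himp_closed)
  then have "(y \<squnion> z) \<sqinter> x \<sqsubseteq> ?w" using c w himp_residual[of x ?w "y \<squnion> z"] by simp
  then have "x \<sqinter> (y \<squnion> z) \<sqsubseteq> ?w" using meet_comm[of H "y \<squnion> z" x] by simp
  moreover have "?w \<sqsubseteq> x \<sqinter> (y \<squnion> z)"
    using c by (intro join_le meet_mono) (simp_all add: join_left join_right)
  ultimately show "x \<sqinter> (y \<squnion> z) = ?w" using c w by (intro le_antisym) simp_all
qed

context heyting_algebra
begin

lemma prime_filter_modus_ponens:
  assumes P: "P \<in> prime_filters H" and c: "u \<in> carrier H" "v \<in> carrier H"
    and uv: "u \<rightharpoonup> v \<in> P" "u \<in> P"
  shows "v \<in> P"
proof -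
  have "(u \<rightharpoonup> v) \<sqinter> u \<sqsubseteq> v" using himp_residual[of u v "u \<rightharpoonup> v"] c himp_closed by simp
  moreover have "(u \<rightharpoonup> v) \<sqinter> u \<in> P" using lattice_filterD(4)[OF prime_filterD(1)[OF P] uv] .
  ultimately show ?thesis using prime_filter_up[OF P _ c(2)] by blast
qed

text \<open>The Kripke clause for implication. If \<open>u \<rightharpoonup> v\<close> is not in
  \<open>P\<close>, residuation keeps the filter generated by \<open>P\<close> and \<open>u\<close>
  away from the ideal below \<open>v\<close>, and a prime filter between them refutes the right-hand
  side.\<close>

lemma himp_mem_prime_filter_iff:
  assumes P: "P \<in> prime_filters H" and c: "u \<in> carrier H" "v \<in> carrier H"
  shows "u \<rightharpoonup> v \<in> P \<longleftrightarrow> (\<forall>Q\<in>prime_filters H. P \<subseteq> Q \<longrightarrow> u \<in> Q \<longrightarrow> v \<in> Q)"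
proof
  assume "u \<rightharpoonup> v \<in> P"
  then show "\<forall>Q\<in>prime_filters H. P \<subseteq> Q \<longrightarrow> u \<in> Q \<longrightarrow> v \<in> Q"
    using prime_filter_modus_ponens[OF _ c] by blast
next
  assume R: "\<forall>Q\<in>prime_filters H. P \<subseteq> Q \<longrightarrow> u \<in> Q \<longrightarrow> v \<in> Q"
  note F = lattice_filter_extend[OF prime_filterD(1)[OF P] c(1)]
  let ?F = "{z \<in> carrier H. \<exists>m\<in>P. m \<sqinter> u \<sqsubseteq> z}" and ?I = "{z \<in> carrier H. z \<sqsubseteq> v}"
  show "u \<rightharpoonup> v \<in> P"
  proof (rule ccontr)
    assume n: "u \<rightharpoonup> v \<notin> P"
    have "?F \<inter> ?I = {}"
    proof (rule equals0I)
      fix z assume "z \<in> ?F \<inter> ?I"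
      then obtain m where m: "m \<in> P" "m \<sqinter> u \<sqsubseteq> z" "z \<sqsubseteq> v" "z \<in> carrier H" by auto
      have mc: "m \<in> carrier H" using m(1) prime_filterD(2)[OF P] by auto
      have "m \<sqinter> u \<sqsubseteq> v" using le_trans[OF m(2,3)] mc c m(4) by simp
      then have "m \<sqsubseteq> u \<rightharpoonup> v" using himp_residual c mc by simp
      then show False using prime_filter_up[OF P m(1) himp_closed] c n by blast
    qed
    then obtain Q where Q: "Q \<in> prime_filters H" "?F \<subseteq> Q" "Q \<inter> ?I = {}"
      by (rule prime_filter_exists[OF F(1) lattice_ideal_principal[OF c(2)]])
    have "P \<subseteq> Q" "u \<in> Q" using F(2,3) Q(2) by auto
    moreover have "v \<notin> Q" using Q(3) c by auto
    ultimately show False using R Q(1) by blast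
  qed
qed

end

text \<open>Prelinearity of the test algebra enters here: \<open>P\<close> contains one of the two
  implications, and modus ponens in \<open>Q1\<close> or \<open>Q2\<close> excludes
  incomparability.\<close>

lemma (in goedel_algebra) prime_filters_above_chain:
  assumes P: "P \<in> prime_filters H" and Q: "Q1 \<in> prime_filters H" "Q2 \<in> prime_filters H" "P \<subseteq> Q1" "P \<subseteq> Q2"
  shows "Q1 \<subseteq> Q2 \<or> Q2 \<subseteq> Q1"
proof (rule ccontr)
  assume "\<not> ?thesis"
  then obtain u v where uv: "u \<in> Q1" "u \<notin> Q2" "v \<in> Q2" "v \<notin> Q1" by blast
  then have c: "u \<in> carrier H" "v \<in> carrier H" using prime_filterD(2) Q(1,2) by blast+
  have "(u \<rightharpoonup> v) \<squnion> (v \<rightharpoonup> u) \<in> P" using prime_filter_top[OF P] prelinear[OF c] by simp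
  then have "u \<rightharpoonup> v \<in> P \<or> v \<rightharpoonup> u \<in> P" using prime_filterD(3)[OF P] himp_closed c by simp
  then show False
    using prime_filter_modus_ponens[OF Q(1) c _ uv(1)] prime_filter_modus_ponens[OF Q(2) c(2,1) _ uv(3)]
      uv Q(3,4) by blast
qed

section \<open>The dual Priestley space and its closed chains\<close>

context bounded_distributive_lattice
begin

lemma priestley_space_dual: "priestley_space (dual_topology L) (dual_order L)"
  unfolding priestley_space_def topspace_dual
proof (intro conjI ballI impI compact_space_dual)
  show "partial_order_on (prime_filters L) (dual_order L)"
    by (auto simp: dual_order_def partial_order_on_def preorder_on_def refl_on_def trans_def antisym_def)
  fix P Q assume PQ: "P \<in> prime_filters L" "Q \<in> prime_filters L" "(P, Q) \<notin> dual_order L"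
  then obtain a where a: "a \<in> P" "a \<notin> Q" by (auto simp: dual_order_def)
  then have "a \<in> carrier L" using prime_filterD(2)[OF PQ(1)] by blast
  then have "clopenin (dual_topology L) (stone_map L a)" by (rule clopenin_stone_map)
  moreover have "upset_of (prime_filters L) (dual_order L) (stone_map L a)"
    by (auto simp: upset_of_def stone_map_def dual_order_def)
  ultimately show "\<exists>U. clopenin (dual_topology L) U \<and> upset_of (prime_filters L) (dual_order L) U \<and> P \<in> U \<and> Q \<notin> U"
    using a PQ by (intro exI[of _ "stone_map L a"]) (auto simp: stone_map_def)
qed

sublocale dual: priestley "dual_topology L" "dual_order L"
  by unfold_locales (rule priestley_space_dual)

lemma stone_map_clopen_upsets:
  assumes "a \<in> carrier L"
  shows "stone_map L a \<in> dual.clopen_upsets"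
proof -
  have "upset_of (prime_filters L) (dual_order L) (stone_map L a)"
    by (auto simp: upset_of_def stone_map_def dual_order_def)
  then show ?thesis using clopenin_stone_map[OF assms] by (simp add: dual.clopen_upsets_def)
qed

text \<open>The Stone sets form a sublattice separating the order, so compactness leaves no other
  clopen upset. Boxes of clopen upsets are therefore exactly the values of \<open>e\<close>.\<close>

lemma dual_clopen_upsets_eq: "dual.clopen_upsets = stone_map L ` carrier L"
proof
  show "stone_map L ` carrier L \<subseteq> dual.clopen_upsets" using stone_map_clopen_upsets by auto
  show "dual.clopen_upsets \<subseteq> stone_map L ` carrier L"
  proof
    fix U assume U: "U \<in> dual.clopen_upsets"
    let ?T = "dual_topology L"
    have clU: "clopenin ?T U" by (rule dual.clopen_upsets_clopen[OF U])
    have UT: "U \<subseteq> prime_filters L" using clopenin_subset[OF clU] by simp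
    obtain V where V: "V \<in> stone_map L ` carrier L" "U \<subseteq> V" "V \<inter> (prime_filters L - U) = {}"
    proof (rule compactin_separation[of ?T U "prime_filters L - U" "stone_map L ` carrier L"])
      have "closedin ?T (prime_filters L - U)"
        using clU clopenin_Diff[OF clopenin_topspace[of ?T] clU] by (simp add: clopenin_def)
      then show "compactin ?T U" "compactin ?T (prime_filters L - U)"
        using clU compact_space_dual closedin_compact_space by (auto simp: clopenin_def)
      show "clopenin ?T V" if "V \<in> stone_map L ` carrier L" for V using that clopenin_stone_map by auto
      show "V \<union> W \<in> stone_map L ` carrier L" if VW: "V \<in> stone_map L ` carrier L" "W \<in> stone_map L ` carrier L" for V W
      proof -
        obtain a b where "a \<in> carrier L" "b \<in> carrier L" "V = stone_map L a" "W = stone_map L b" using VW by auto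
        then show ?thesis by (intro image_eqI[of _ _ "a \<squnion> b"]) (auto simp: stone_map_join)
      qed
      show "V \<inter> W \<in> stone_map L ` carrier L" if VW: "V \<in> stone_map L ` carrier L" "W \<in> stone_map L ` carrier L" for V W
      proof -
        obtain a b where "a \<in> carrier L" "b \<in> carrier L" "V = stone_map L a" "W = stone_map L b" using VW by auto
        then show ?thesis by (intro image_eqI[of _ _ "a \<sqinter> b"]) (auto simp: stone_map_meet)
      qed
      show "{} \<in> stone_map L ` carrier L" using stone_map_bottom by (intro image_eqI[of _ _ \<bottom>]) auto
      show "topspace ?T \<in> stone_map L ` carrier L" using stone_map_top by (intro image_eqI[of _ _ \<top>]) auto
      fix P Q assume P: "P \<in> U" and Q: "Q \<in> prime_filters L - U"
      then have "\<not> P \<subseteq> Q" using dual.clopen_upsets_up[OF U P, of Q] UT by (auto simp: dual_order_def)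
      then obtain a where a: "a \<in> P" "a \<notin> Q" by blast
      moreover have "a \<in> carrier L" using a(1) prime_filterD(2) P UT by blast
      ultimately show "\<exists>V\<in>stone_map L ` carrier L. P \<in> V \<and> Q \<notin> V"
        using P UT by (intro bexI[of _ "stone_map L a"]) (auto simp: stone_map_def)
    qed
    have "V \<subseteq> prime_filters L" using V(1) stone_map_subset by auto
    then have "V = U" using V(2,3) by auto
    then show "U \<in> stone_map L ` carrier L" using V(1) by simp
  qed
qed

text \<open>The intersection of a chain of prime filters is prime. Were it outside \<open>C\<close>,
  some \<open>U - V\<close> around it would miss \<open>C\<close>; every member of \<open>C\<close>
  lies above it, hence in \<open>U\<close> and so in \<open>V\<close>. But \<open>V\<close> is the
  Stone set of some \<open>b\<close>, which then belongs to the intersection too.\<close>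

lemma Inter_mem_closed_chain:
  assumes C: "C \<in> closed_chains (dual_topology L) (dual_order L)"
  shows "\<Inter>C \<in> C"
proof (rule ccontr)
  assume n: "\<Inter>C \<notin> C"
  have ne: "C \<noteq> {}" and cl: "closedin (dual_topology L) C" using C by (auto simp: closed_chains_def)
  have CT: "C \<subseteq> prime_filters L" using closed_chains_subset[OF C] by simp
  have chain: "P \<subseteq> Q \<or> Q \<subseteq> P" if "P \<in> C" "Q \<in> C" for P Q
    using dual.chain_cmp[OF C that] by (auto simp: dual_order_def)
  obtain P0 where P0: "P0 \<in> C" using ne by blast
  have P0p: "P0 \<in> prime_filters L" using P0 CT by blast
  have pf: "\<Inter>C \<in> prime_filters L"
    unfolding prime_filters_def prime_filter_def mem_Collect_eq
  proof (intro conjI ballI impI)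
    show "\<Inter>C \<subseteq> carrier L" using P0 prime_filterD(2)[OF P0p] by blast
    have "\<top> \<in> \<Inter>C" using prime_filter_top CT by blast
    then show "\<Inter>C \<noteq> {}" by blast
    have "\<bottom> \<notin> \<Inter>C" using P0 prime_filter_bottom[OF P0p] by blast
    then show "\<Inter>C \<noteq> carrier L" using bottom_closed by metis
    show "y \<in> \<Inter>C" if "x \<in> \<Inter>C" "y \<in> carrier L" "x \<sqsubseteq> y" for x y
      using that prime_filter_up[of _ L x y] CT by blast
    show "x \<sqinter> y \<in> \<Inter>C" if "x \<in> \<Inter>C" "y \<in> \<Inter>C" for x y
      using that lattice_filterD(4)[OF prime_filterD(1), of _ L x y] CT by blast
    show "x \<in> \<Inter>C \<or> y \<in> \<Inter>C" if xy: "x \<in> carrier L" "y \<in> carrier L" "x \<squnion> y \<in> \<Inter>C" for x y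
    proof (rule ccontr)
      assume "\<not> ?thesis"
      then obtain P Q where PQ: "P \<in> C" "x \<notin> P" "Q \<in> C" "y \<notin> Q" by blast
      \<comment> \<open>Of one member omitting \<open>x\<close> and one omitting \<open>y\<close>,
        the smaller omits both.\<close>
      then obtain S where S: "S \<in> C" "x \<notin> S" "y \<notin> S" using chain[of P Q] by blast
      then have "x \<squnion> y \<in> S" "S \<in> prime_filters L" using xy(3) CT by blast+
      then show False using prime_filterD(3)[of S L x y] xy S by blast
    qed
  qed
  then obtain U V where UV: "U \<in> dual.clopen_upsets" "V \<in> dual.clopen_upsets" "\<Inter>C \<in> U - V" "(U - V) \<inter> C = {}"
    using dual.point_separation[OF cl _ n] by auto
  obtain b where b: "V = stone_map L b" "b \<in> carrier L" using UV(2) unfolding dual_clopen_upsets_eq by auto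
  have "b \<in> P" if P: "P \<in> C" for P
  proof -
    have "(\<Inter>C, P) \<in> dual_order L" using P pf CT by (auto simp: dual_order_def)
    then have "P \<in> U" using dual.clopen_upsets_up[OF UV(1)] UV(3) by blast
    then have "P \<in> V" using UV(4) P by blast
    then show ?thesis by (simp add: b stone_map_def)
  qed
  then have "\<Inter>C \<in> V" using pf by (auto simp: b stone_map_def)
  then show False using UV(3) by blast
qed

end

section \<open>Freeness\<close>

context bounded_distributive_lattice
begin

sublocale cc: esakia "cc_topology (dual_topology L) (dual_order L)" "cc_order (dual_topology L) (dual_order L)"
  by unfold_locales (rule dual.priestley_space_cc, rule dual.esakia_space_cc)

lemma cc_clopen_upsets_eq: "cc.clopen_upsets = dual.cc_clopen_upsets"
  by (simp add: cc.clopen_upsets_def dual.cc_clopen_upsets_def)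

abbreviation "Box \<equiv> cc_box (dual_topology L) (dual_order L)"

lemma cc_box_stone_map_clopen_upsets: "a \<in> carrier L \<Longrightarrow> Box (stone_map L a) \<in> cc.clopen_upsets"
  unfolding cc_clopen_upsets_eq by (intro dual.cc_box_clopen_upsets clopenin_stone_map)

text \<open>This rests on members being chains: a point outside the first Stone set lies in the
  second and vice versa, and if two such points were comparable, the upper one would lie in the set
  that it avoids.\<close>

lemma cc_box_stone_map_join:
  assumes "a \<in> carrier L" "b \<in> carrier L"
  shows "Box (stone_map L (a \<squnion> b)) = Box (stone_map L a) \<union> Box (stone_map L b)"
proof (intro equalityI subsetI)
  fix C assume C: "C \<in> Box (stone_map L (a \<squnion> b))"
  show "C \<in> Box (stone_map L a) \<union> Box (stone_map L b)"
  proof (rule ccontr)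
    assume "\<not> ?thesis"
    then obtain P Q where PQ: "P \<in> C" "P \<notin> stone_map L a" "Q \<in> C" "Q \<notin> stone_map L b"
      using C by (auto simp: cc_box_def)
    then have "P \<in> stone_map L b" "Q \<in> stone_map L a"
      using C stone_map_join[OF assms] by (auto simp: cc_box_def)
    moreover have "(P, Q) \<in> dual_order L \<or> (Q, P) \<in> dual_order L"
      using dual.chain_cmp[of C P Q] C PQ by (auto simp: cc_box_def)
    ultimately show False
      using PQ dual.clopen_upsets_up[OF stone_map_clopen_upsets[OF assms(1)], of Q P]
        dual.clopen_upsets_up[OF stone_map_clopen_upsets[OF assms(2)], of P Q] by blast
  qed
qed (use stone_map_join[OF assms] in \<open>auto simp: cc_box_def\<close>)

lemma bounded_lattice_hom_cc_box:
  "bounded_lattice_hom L cc.A (\<lambda>a. Box (stone_map L a))"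
proof -
  interpret A: bounded_lattice cc.A by (rule cc.bounded_lattice_A)
  have "Box {} = {}" by (auto simp: cc_box_def closed_chains_def)
  moreover have "Box (prime_filters L) = topspace (cc_topology (dual_topology L) (dual_order L))"
    using cc_box_topspace[of "dual_topology L" "dual_order L"] by simp
  moreover have "Box (stone_map L (a \<sqinter> b)) = Box (stone_map L a) \<inter> Box (stone_map L b)"
    if "a \<in> carrier L" "b \<in> carrier L" for a b
    using stone_map_meet[OF that] by (auto simp: cc_box_def)
  ultimately show ?thesis
    unfolding bounded_lattice_hom_def join_pres_def meet_pres_def
    using lattice_axioms A.lattice_axioms
    by (simp add: cc_box_stone_map_clopen_upsets cc_box_stone_map_join cc.join_A cc.meet_A cc.top_A cc.bottom_A
        stone_map_top stone_map_bottom)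
qed

end

section \<open>Lifting a lattice homomorphism into a Goedel algebra\<close>

locale goedel_extension =
  L: bounded_distributive_lattice L + H: goedel_algebra H
  for L :: "('a, 'm) gorder_scheme" and H :: "('h, 'n) heyting_scheme" +
  fixes f :: "'a \<Rightarrow> 'h"
  assumes hom: "bounded_lattice_hom L H f"
begin

lemma f_closed: "a \<in> carrier L \<Longrightarrow> f a \<in> carrier H"
  and f_join: "a \<in> carrier L \<Longrightarrow> b \<in> carrier L \<Longrightarrow> f (a \<squnion>\<^bsub>L\<^esub> b) = f a \<squnion>\<^bsub>H\<^esub> f b"
  and f_meet: "a \<in> carrier L \<Longrightarrow> b \<in> carrier L \<Longrightarrow> f (a \<sqinter>\<^bsub>L\<^esub> b) = f a \<sqinter>\<^bsub>H\<^esub> f b"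
  and f_bottom: "f \<bottom>\<^bsub>L\<^esub> = \<bottom>\<^bsub>H\<^esub>"
  and f_top: "f \<top>\<^bsub>L\<^esub> = \<top>\<^bsub>H\<^esub>"
  using hom by (auto simp: bounded_lattice_hom_def join_pres_def meet_pres_def)

lemma f_mono:
  assumes "a \<in> carrier L" "b \<in> carrier L" "a \<sqsubseteq>\<^bsub>L\<^esub> b"
  shows "f a \<sqsubseteq>\<^bsub>H\<^esub> f b"
proof -
  have "a \<squnion>\<^bsub>L\<^esub> b = b" using assms L.le_iff_meet by simp
  then show ?thesis using f_join[OF assms(1,2)] H.join_left[OF f_closed f_closed, OF assms(1,2)] by simp
qed

text \<open>The Priestley dual of \<open>f\<close>, cut down to the carrier because \<open>f\<close>
  is unconstrained outside it.\<close>

definition pull :: "'h set \<Rightarrow> 'a set" where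
  "pull Q = {a \<in> carrier L. f a \<in> Q}"

definition above :: "'h set \<Rightarrow> 'h set set" where
  "above P = {Q \<in> prime_filters H. P \<subseteq> Q}"

lemma pull_mono: "P \<subseteq> Q \<Longrightarrow> pull P \<subseteq> pull Q"
  by (auto simp: pull_def)

lemma pull_prime_filter:
  assumes Q: "Q \<in> prime_filters H"
  shows "pull Q \<in> prime_filters L"
  unfolding prime_filters_def prime_filter_def mem_Collect_eq
proof (intro conjI ballI impI)
  show "pull Q \<subseteq> carrier L" by (auto simp: pull_def)
  have "\<top>\<^bsub>L\<^esub> \<in> pull Q" using H.prime_filter_top[OF Q] by (simp add: pull_def f_top)
  then show "pull Q \<noteq> {}" by blast
  have "\<bottom>\<^bsub>L\<^esub> \<notin> pull Q" using H.prime_filter_bottom[OF Q] by (simp add: pull_def f_bottom)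
  then show "pull Q \<noteq> carrier L" using L.bottom_closed by metis
  show "y \<in> pull Q" if "x \<in> pull Q" "y \<in> carrier L" "x \<sqsubseteq>\<^bsub>L\<^esub> y" for x y
    using that prime_filter_up[OF Q, of "f x" "f y"] f_mono f_closed by (simp add: pull_def)
  show "x \<sqinter>\<^bsub>L\<^esub> y \<in> pull Q" if "x \<in> pull Q" "y \<in> pull Q" for x y
    using that lattice_filterD(4)[OF prime_filterD(1)[OF Q], of "f x" "f y"] by (simp add: pull_def f_meet)
  show "x \<in> pull Q \<or> y \<in> pull Q" if "x \<in> carrier L" "y \<in> carrier L" "x \<squnion>\<^bsub>L\<^esub> y \<in> pull Q" for x y
    using that prime_filterD(3)[OF Q, of "f x" "f y"] by (simp add: pull_def f_join f_closed)
qed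

lemma pull_stone_map:
  "a \<in> carrier L \<Longrightarrow> Q \<in> prime_filters H \<Longrightarrow> pull Q \<in> stone_map L a \<longleftrightarrow> Q \<in> stone_map H (f a)"
  using pull_prime_filter by (auto simp: stone_map_def pull_def)

lemma continuous_map_pull: "continuous_map (dual_topology H) (dual_topology L) pull"
  unfolding dual_topology_def[of L]
proof (rule continuous_on_generated_topo)
  fix U assume "U \<in> stone_map L ` carrier L \<union> (\<lambda>a. prime_filters L - stone_map L a) ` carrier L"
  then obtain a where a: "a \<in> carrier L" and U: "U = stone_map L a \<or> U = prime_filters L - stone_map L a"
    by auto
  have "clopenin (dual_topology H) (stone_map H (f a))" by (rule H.clopenin_stone_map[OF f_closed[OF a]])
  then have o: "openin (dual_topology H) (stone_map H (f a))"
      "openin (dual_topology H) (prime_filters H - stone_map H (f a))"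
    by (simp_all add: clopenin_def closedin_def)
  have "pull -` U \<inter> prime_filters H = stone_map H (f a) \<or>
      pull -` U \<inter> prime_filters H = prime_filters H - stone_map H (f a)"
    using U
  proof
    assume "U = stone_map L a"
    then have "pull -` U \<inter> prime_filters H = stone_map H (f a)"
      using pull_stone_map[OF a] H.stone_map_subset by auto
    then show ?thesis ..
  next
    assume "U = prime_filters L - stone_map L a"
    then have "pull -` U \<inter> prime_filters H = prime_filters H - stone_map H (f a)"
      using pull_stone_map[OF a] pull_prime_filter by auto
    then show ?thesis ..
  qed
  then show "openin (dual_topology H) (pull -` U \<inter> topspace (dual_topology H))"
    using o by auto
next
  have "\<Union>(stone_map L ` carrier L \<union> (\<lambda>a. prime_filters L - stone_map L a) ` carrier L) = prime_filters L"
    using L.topspace_dual by (simp add: dual_topology_def)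
  then show "pull ` topspace (dual_topology H)
      \<subseteq> \<Union>(stone_map L ` carrier L \<union> (\<lambda>a. prime_filters L - stone_map L a) ` carrier L)"
    using pull_prime_filter by auto
qed

lemma above_self: "P \<in> prime_filters H \<Longrightarrow> P \<in> above P"
  by (simp add: above_def)

text \<open>Closed as a continuous image of a compact set in a Hausdorff space; a chain because
  \<open>above P\<close> is one and \<open>pull\<close> is monotone.\<close>

lemma pull_above_closed_chain:
  assumes P: "P \<in> prime_filters H"
  shows "pull ` above P \<in> closed_chains (dual_topology L) (dual_order L)"
proof -
  have "above P = dual_order H `` {P}" using P by (auto simp: above_def dual_order_def)
  then have "closedin (dual_topology H) (above P)" using H.dual.closedin_principal_upset by simp
  then have "compactin (dual_topology H) (above P)"
    using H.compact_space_dual closedin_compact_space by blast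
  then have "compactin (dual_topology L) (pull ` above P)"
    using continuous_map_pull by (rule image_compactin)
  then have "closedin (dual_topology L) (pull ` above P)"
    by (rule compactin_imp_closedin[OF L.dual.Hausdorff])
  moreover have "(pull Q1, pull Q2) \<in> dual_order L \<or> (pull Q2, pull Q1) \<in> dual_order L"
    if "Q1 \<in> above P" "Q2 \<in> above P" for Q1 Q2
    using H.prime_filters_above_chain[OF P, of Q1 Q2] that pull_mono pull_prime_filter
    by (auto simp: above_def dual_order_def)
  ultimately show ?thesis
    using above_self[OF P] by (auto simp: closed_chains_def Chains_def)
qed

text \<open>The map \<open>P \<mapsto> pull ` above P\<close> is dual to the homomorphism to be constructed, and
  this is the condition for it to be a p-morphism.\<close>

lemma cc_order_pull_above_iff:
  assumes P: "P \<in> prime_filters H"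
  shows "(pull ` above P, D) \<in> cc_order (dual_topology L) (dual_order L) \<longleftrightarrow> (\<exists>Q\<in>above P. D = pull ` above Q)"
proof
  assume PD: "(pull ` above P, D) \<in> cc_order (dual_topology L) (dual_order L)"
  have "\<Inter>D \<in> D" by (rule L.Inter_mem_closed_chain[OF cc_orderD(2)[OF PD]])
  then obtain Q where Q: "Q \<in> above P" and DQ: "\<Inter>D = pull Q" using cc_orderD(3)[OF PD] by blast
  have "D = pull ` above Q"
  proof (intro equalityI subsetI)
    fix x assume "x \<in> pull ` above Q"
    then obtain S where S: "S \<in> above Q" "x = pull S" by auto
    have "S \<in> above P" using S Q by (auto simp: above_def)
    moreover have "(\<Inter>D, x) \<in> dual_order L"
      using S Q pull_mono[of Q S] pull_prime_filter unfolding DQ by (auto simp: above_def dual_order_def)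
    ultimately show "x \<in> D" using cc_orderD(4)[OF PD \<open>\<Inter>D \<in> D\<close>] S(2) by blast
  next
    fix x assume x: "x \<in> D"
    then obtain S where S: "S \<in> above P" "x = pull S" using cc_orderD(3)[OF PD] by blast
    have "pull Q \<subseteq> x" using x DQ by blast
    have "Q \<subseteq> S \<or> S \<subseteq> Q"
      using H.prime_filters_above_chain[OF P, of Q S] Q S(1) by (auto simp: above_def)
    then show "x \<in> pull ` above Q"
    proof
      assume "Q \<subseteq> S"
      then show ?thesis using S by (auto simp: above_def)
    next
      \<comment> \<open>\<open>pull\<close> need not be injective: a filter \<open>S\<close> below
        \<open>Q\<close> may still have its image in \<open>D\<close>, but then this image equals
        that of \<open>Q\<close>.\<close>
      assume "S \<subseteq> Q"
      then have "x = pull Q" using pull_mono[of S Q] S(2) \<open>pull Q \<subseteq> x\<close> by blast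
      then show ?thesis using above_self[of Q] Q by (auto simp: above_def)
    qed
  qed
  then show "\<exists>Q\<in>above P. D = pull ` above Q" using Q by blast
next
  assume "\<exists>Q\<in>above P. D = pull ` above Q"
  then obtain Q where Q: "Q \<in> above P" and D: "D = pull ` above Q" by blast
  have Qp: "Q \<in> prime_filters H" and PQ: "P \<subseteq> Q" using Q by (auto simp: above_def)
  show "(pull ` above P, D) \<in> cc_order (dual_topology L) (dual_order L)"
    unfolding D
  proof (rule cc_orderI)
    show "pull ` above Q \<subseteq> pull ` above P" using PQ by (auto simp: above_def)
    fix x y assume x: "x \<in> pull ` above Q" and y: "y \<in> pull ` above P" and xy: "(x, y) \<in> dual_order L"
    obtain S where S: "S \<in> above Q" "x = pull S" using x by auto
    obtain S' where S': "S' \<in> above P" "y = pull S'" using y by auto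
    have Sp: "S \<in> above P" using S PQ by (auto simp: above_def)
    have "S \<subseteq> S' \<or> S' \<subseteq> S"
      using H.prime_filters_above_chain[OF P, of S S'] Sp S'(1) by (auto simp: above_def)
    then show "y \<in> pull ` above Q"
    proof
      assume "S \<subseteq> S'"
      then show ?thesis using S S' by (auto simp: above_def)
    next
      assume "S' \<subseteq> S"
      then have "y = x" using pull_mono[of S' S] S(2) S'(2) xy by (auto simp: dual_order_def)
      then show ?thesis using x by simp
    qed
  qed (intro pull_above_closed_chain P Qp)+
qed

definition preimage :: "'a set set set \<Rightarrow> 'h set set" where
  "preimage \<U> = {P \<in> prime_filters H. pull ` above P \<in> \<U>}"

text \<open>\<open>pull P\<close> is the least member of the image chain of \<open>P\<close>, so it
  alone decides whether the chain lies inside the upset \<open>stone_map L a\<close>.\<close>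

lemma preimage_box:
  assumes a: "a \<in> carrier L"
  shows "preimage (L.Box (stone_map L a)) = stone_map H (f a)"
proof (intro equalityI subsetI)
  fix P assume "P \<in> preimage (L.Box (stone_map L a))"
  then have P: "P \<in> prime_filters H" and "pull P \<in> stone_map L a"
    using above_self by (auto simp: preimage_def cc_box_def)
  then show "P \<in> stone_map H (f a)" using pull_stone_map[OF a P] by simp
next
  fix P assume P: "P \<in> stone_map H (f a)"
  then have Pp: "P \<in> prime_filters H" by (simp add: stone_map_def)
  have "pull Q \<in> stone_map L a" if "Q \<in> above P" for Q
    using that P pull_stone_map[OF a, of Q] by (auto simp: above_def stone_map_def)
  then show "P \<in> preimage (L.Box (stone_map L a))"
    using Pp pull_above_closed_chain[OF Pp] by (auto simp: preimage_def cc_box_def)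
qed

lemma preimage_Un: "preimage (\<U> \<union> \<V>) = preimage \<U> \<union> preimage \<V>"
  and preimage_Int: "preimage (\<U> \<inter> \<V>) = preimage \<U> \<inter> preimage \<V>"
  by (auto simp: preimage_def)

text \<open>By the p-morphism condition, the chains above the image of \<open>P\<close> are the
  images of the prime filters above \<open>P\<close>, which turns implication of upsets into the
  Kripke clause for \<open>u \<rightharpoonup> v\<close>.\<close>

lemma preimage_himp:
  assumes uv: "u \<in> carrier H" "v \<in> carrier H" "preimage \<U> = stone_map H u" "preimage \<V> = stone_map H v"
  shows "preimage (closed_chains (dual_topology L) (dual_order L) -
      (cc_order (dual_topology L) (dual_order L))\<inverse> `` (\<U> - \<V>)) = stone_map H (u \<rightharpoonup>\<^bsub>H\<^esub> v)"
    (is "preimage (?K - ?D) = _")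
proof -
  have "pull ` above P \<in> ?K - ?D \<longleftrightarrow> u \<rightharpoonup>\<^bsub>H\<^esub> v \<in> P" if P: "P \<in> prime_filters H" for P
  proof -
    have "pull ` above P \<in> ?K - ?D \<longleftrightarrow>
        \<not> (\<exists>D. (pull ` above P, D) \<in> cc_order (dual_topology L) (dual_order L) \<and> D \<in> \<U> - \<V>)"
      using pull_above_closed_chain[OF P] by auto
    also have "\<dots> \<longleftrightarrow> (\<forall>Q\<in>above P. pull ` above Q \<in> \<U> \<longrightarrow> pull ` above Q \<in> \<V>)"
      unfolding cc_order_pull_above_iff[OF P] by auto
    also have "\<dots> \<longleftrightarrow> (\<forall>Q\<in>above P. Q \<in> preimage \<U> \<longrightarrow> Q \<in> preimage \<V>)"
      by (auto simp: preimage_def above_def)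
    also have "\<dots> \<longleftrightarrow> (\<forall>Q\<in>prime_filters H. P \<subseteq> Q \<longrightarrow> u \<in> Q \<longrightarrow> v \<in> Q)"
      unfolding uv(3,4) by (auto simp: stone_map_def above_def)
    also have "\<dots> \<longleftrightarrow> u \<rightharpoonup>\<^bsub>H\<^esub> v \<in> P"
      by (rule H.himp_mem_prime_filter_iff[OF P uv(1,2), symmetric])
    finally show ?thesis .
  qed
  then show ?thesis by (auto simp: preimage_def stone_map_def)
qed

text \<open>Guarantees that \<open>lift\<close> has a value to choose, by induction on how the
  clopen upset is generated from boxes.\<close>

lemma preimage_stone_map:
  assumes "\<U> \<in> L.dual.cc_clopen_upsets"
  shows "preimage \<U> \<in> stone_map H ` carrier H"
  using assms
proof (induction rule: L.dual.cc_clopen_upsets_induct)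
  case (box U)
  then obtain a where "a \<in> carrier L" "U = stone_map L a" unfolding L.dual_clopen_upsets_eq by auto
  then show ?case using preimage_box f_closed by auto
next
  case (Un \<U> \<V>)
  then obtain u v where uv: "u \<in> carrier H" "v \<in> carrier H" "preimage \<U> = stone_map H u" "preimage \<V> = stone_map H v" by auto
  then show ?case by (intro image_eqI[of _ _ "u \<squnion>\<^bsub>H\<^esub> v"]) (simp_all add: preimage_Un H.stone_map_join)
next
  case (Int \<U> \<V>)
  then obtain u v where uv: "u \<in> carrier H" "v \<in> carrier H" "preimage \<U> = stone_map H u" "preimage \<V> = stone_map H v" by auto
  then show ?case by (intro image_eqI[of _ _ "u \<sqinter>\<^bsub>H\<^esub> v"]) (simp_all add: preimage_Int H.stone_map_meet)
next
  case (imp \<U> \<V>)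
  then obtain u v where uv: "u \<in> carrier H" "v \<in> carrier H" "preimage \<U> = stone_map H u" "preimage \<V> = stone_map H v" by auto
  then show ?case
    using preimage_himp[OF uv] H.himp_closed[OF uv(1,2)] by (intro image_eqI[of _ _ "u \<rightharpoonup>\<^bsub>H\<^esub> v"])
qed

text \<open>Injectivity of the Stone map makes the inverse image unambiguous; the restriction makes
  the map extensional, as the uniqueness statement demands.\<close>

definition lift :: "'a set set set \<Rightarrow> 'h" where
  "lift = restrict (\<lambda>\<U>. inv_into (carrier H) (stone_map H) (preimage \<U>)) L.cc.clopen_upsets"

lemma lift_eqI:
  assumes "\<U> \<in> L.cc.clopen_upsets" "h \<in> carrier H" "preimage \<U> = stone_map H h"
  shows "lift \<U> = h"
  using assms by (simp add: lift_def inv_into_f_f[OF H.inj_on_stone_map])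

lemma lift:
  assumes "\<U> \<in> L.cc.clopen_upsets"
  shows "lift \<U> \<in> carrier H" "preimage \<U> = stone_map H (lift \<U>)"
proof -
  obtain h where "h \<in> carrier H" "preimage \<U> = stone_map H h"
    using preimage_stone_map assms unfolding L.cc_clopen_upsets_eq by auto
  then show "lift \<U> \<in> carrier H" "preimage \<U> = stone_map H (lift \<U>)" using lift_eqI[OF assms] by simp_all
qed

lemma heyting_hom_lift: "heyting_hom L.cc.A H lift"
proof -
  interpret A: heyting_algebra L.cc.A by (rule L.cc.heyting_algebra_A)
  have "lift (\<U> \<union> \<V>) = lift \<U> \<squnion>\<^bsub>H\<^esub> lift \<V>" "lift (\<U> \<inter> \<V>) = lift \<U> \<sqinter>\<^bsub>H\<^esub> lift \<V>"
    "lift (closed_chains (dual_topology L) (dual_order L) -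
      (cc_order (dual_topology L) (dual_order L))\<inverse> `` (\<U> - \<V>)) = lift \<U> \<rightharpoonup>\<^bsub>H\<^esub> lift \<V>"
    if UV: "\<U> \<in> L.cc.clopen_upsets" "\<V> \<in> L.cc.clopen_upsets" for \<U> \<V>
  proof -
    note e = lift[OF UV(1)] lift[OF UV(2)]
    show "lift (\<U> \<union> \<V>) = lift \<U> \<squnion>\<^bsub>H\<^esub> lift \<V>"
      using e by (intro lift_eqI L.cc.clopen_upsets_Un UV) (simp_all add: preimage_Un H.stone_map_join)
    show "lift (\<U> \<inter> \<V>) = lift \<U> \<sqinter>\<^bsub>H\<^esub> lift \<V>"
      using e by (intro lift_eqI L.cc.clopen_upsets_Int UV) (simp_all add: preimage_Int H.stone_map_meet)
    show "lift (closed_chains (dual_topology L) (dual_order L) -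
      (cc_order (dual_topology L) (dual_order L))\<inverse> `` (\<U> - \<V>)) = lift \<U> \<rightharpoonup>\<^bsub>H\<^esub> lift \<V>"
      using L.cc.himp_clopen_upsets[OF UV] by (intro lift_eqI preimage_himp H.himp_closed e) simp_all
  qed
  moreover have "lift {} = \<bottom>\<^bsub>H\<^esub>"
    by (intro lift_eqI L.cc.clopen_upsets_empty H.bottom_closed) (simp add: preimage_def H.stone_map_bottom)
  moreover have "lift (closed_chains (dual_topology L) (dual_order L)) = \<top>\<^bsub>H\<^esub>"
  proof (intro lift_eqI H.top_closed)
    show "closed_chains (dual_topology L) (dual_order L) \<in> L.cc.clopen_upsets"
      using L.cc.clopen_upsets_topspace by simp
    show "preimage (closed_chains (dual_topology L) (dual_order L)) = stone_map H \<top>\<^bsub>H\<^esub>"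
      using pull_above_closed_chain by (auto simp: preimage_def H.stone_map_top)
  qed
  ultimately show ?thesis
    unfolding heyting_hom_def bounded_lattice_hom_def join_pres_def meet_pres_def
    using A.lattice_axioms H.lattice_axioms
    by (simp add: lift(1) L.cc.join_A L.cc.meet_A L.cc.top_A L.cc.bottom_A)
qed

lemma lift_box: "a \<in> carrier L \<Longrightarrow> lift (L.Box (stone_map L a)) = f a"
  by (intro lift_eqI L.cc_box_stone_map_clopen_upsets f_closed preimage_box)

lemma lift_unique:
  assumes g: "g \<in> extensional L.cc.clopen_upsets" "heyting_hom L.cc.A H g"
    and box: "\<And>a. a \<in> carrier L \<Longrightarrow> g (L.Box (stone_map L a)) = f a"
  shows "g = lift"
proof (rule extensionalityI[OF g(1)])
  show "lift \<in> extensional L.cc.clopen_upsets" by (simp add: lift_def)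
  \<comment> \<open>Proved for any homomorphism \<open>h\<close>, so that the induction below can
    use it for both \<open>g\<close> and \<open>lift\<close>.\<close>
  have hom: "h (\<U> \<union> \<V>) = h \<U> \<squnion>\<^bsub>H\<^esub> h \<V>" "h (\<U> \<inter> \<V>) = h \<U> \<sqinter>\<^bsub>H\<^esub> h \<V>"
    "h (closed_chains (dual_topology L) (dual_order L) -
      (cc_order (dual_topology L) (dual_order L))\<inverse> `` (\<U> - \<V>)) = h \<U> \<rightharpoonup>\<^bsub>H\<^esub> h \<V>"
    if h: "heyting_hom L.cc.A H h" and UV: "\<U> \<in> L.cc.clopen_upsets" "\<V> \<in> L.cc.clopen_upsets" for h \<U> \<V>
  proof -
    have "h (\<U> \<squnion>\<^bsub>L.cc.A\<^esub> \<V>) = h \<U> \<squnion>\<^bsub>H\<^esub> h \<V>" "h (\<U> \<sqinter>\<^bsub>L.cc.A\<^esub> \<V>) = h \<U> \<sqinter>\<^bsub>H\<^esub> h \<V>"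
      "h (\<U> \<rightharpoonup>\<^bsub>L.cc.A\<^esub> \<V>) = h \<U> \<rightharpoonup>\<^bsub>H\<^esub> h \<V>"
      using h UV by (simp_all add: heyting_hom_def bounded_lattice_hom_def join_pres_def meet_pres_def)
    then show "h (\<U> \<union> \<V>) = h \<U> \<squnion>\<^bsub>H\<^esub> h \<V>" "h (\<U> \<inter> \<V>) = h \<U> \<sqinter>\<^bsub>H\<^esub> h \<V>"
      "h (closed_chains (dual_topology L) (dual_order L) -
        (cc_order (dual_topology L) (dual_order L))\<inverse> `` (\<U> - \<V>)) = h \<U> \<rightharpoonup>\<^bsub>H\<^esub> h \<V>"
      using L.cc.join_A[OF UV] L.cc.meet_A[OF UV] by simp_all
  qed
  fix \<U> assume "\<U> \<in> L.cc.clopen_upsets"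
  then have "\<U> \<in> L.dual.cc_clopen_upsets" unfolding L.cc_clopen_upsets_eq .
  then show "g \<U> = lift \<U>"
  proof (induction rule: L.dual.cc_clopen_upsets_induct)
    case (box U)
    then obtain a where "a \<in> carrier L" "U = stone_map L a" unfolding L.dual_clopen_upsets_eq by auto
    then show ?case using assms(3) lift_box by simp
  qed (simp_all add: hom[OF g(2)] hom[OF heyting_hom_lift] L.cc_clopen_upsets_eq)
qed

end

theorem theorem3p19:
  fixes L :: "('a, 'm) gorder_scheme"
    and X :: "'a set topology" and r :: "('a set \<times> 'a set) set"
    and CC :: "'a set set topology" and R :: "('a set set \<times> 'a set set) set"
  assumes "bounded_distributive_lattice L"
  defines "X \<equiv> dual_topology L" and "r \<equiv> dual_order L"
  defines "CC \<equiv> cc_topology X r" and "R \<equiv> cc_order X r"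
  shows "priestley_space X r \<and>
         esakia_space CC R \<and> root_system (topspace CC) R \<and>
         free_goedel_over TYPE('h) L (clopen_upset_algebra CC R)
           (\<lambda>a. cc_box X r (stone_map L a))"
proof -
  interpret L: bounded_distributive_lattice L by fact
  have "\<exists>!g. g \<in> extensional (carrier L.cc.A) \<and> heyting_hom L.cc.A H g \<and>
      (\<forall>a\<in>carrier L. g (L.Box (stone_map L a)) = f a)"
    if "goedel_algebra H" "bounded_lattice_hom L H f" for H :: "'h heyting" and f
  proof -
    interpret goedel_extension L H f
      using that by (intro goedel_extension.intro goedel_extension_axioms.intro assms(1))
    show ?thesis
    proof (rule ex1I[of _ lift], intro conjI ballI)
      show "lift \<in> extensional (carrier L.cc.A)" by (simp add: lift_def)
    qed (use lift_unique lift_box heyting_hom_lift in auto)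
  qed
  then have "free_goedel_over TYPE('h) L L.cc.A (\<lambda>a. L.Box (stone_map L a))"
    unfolding free_goedel_over_def
    using L.cc.goedel_algebra_A L.dual.root_system_cc L.bounded_lattice_hom_cc_box by simp
  then show ?thesis
    unfolding X_def r_def CC_def R_def
    using L.priestley_space_dual L.dual.esakia_space_cc L.dual.root_system_cc by simp
qed

end
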